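(* Let $N\ge1$ be an integer, let $q\ge\frac{3}{2N+2}$, and let $f,g\in\mathcal{S}(2q)$ with frequency sets $Y^f,Y^g$ and coefficients $(c^f_y)_{y\in Y^f}$, $(c^g_y)_{y\in Y^g}$, all of modulus at least $c_{\min}\in\mathbb{R}_{>0}$. Let $$\mathbf{f}=(f(k))_{k=-N,\dots,N},\quad \mathbf{g}=(g(k))_{k=-N,\dots,N},\quad \boldsymbol{\eta}=(\eta_k)_{k=-N,\dots,N}\ \in\ \mathbb{C}^{2N+1},$$ where $\eta_k=X_{k,1}+iX_{k,2}$ and the $X_{k,j}$ ($-N\le k\le N$, $j=1,2$) are independent Gaussian random variables with mean zero and variance $\sigma^2$, $\sigma>0$. Let $\delta\in(0,1)$ and put $$R=\left(\left|\|\mathbf{f}+\boldsymbol{\eta}-\mathbf{g}\|_2^2-2(2N+1)\sigma^2\right|^{1/2}+(2+\sqrt2)\,\sigma\,(2N+1)^{(1+\delta)/4}\right)^2 .$$ Then with probability at least $$1-e^{-(2N+1)^{(1+\delta)/2}}-2e^{-(2N+1)^{\delta}/8}$$ the following holds: if $R\le\frac{4N+4}{3}c_{\min}^2$, then for every $y\in Y^f$ there is exactly one $n(y)\in Y^g$ with $|y-n(y)|_{\mathbb{T}}<\frac{3}{2N+2}$, and furthermore $$\sum_{y\in Y^f}\left[\frac{N+1}{3}\left|c^f_y-c^g_{n(y)}\right|^2+\frac{2\pi^2(N+1)^3}{3^5}\,|y-n(y)|_{\mathbb{T}}^2\,\left|c^f_y+c^g_{n(y)}\right|^2\right]\ \le\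 R .$$
   Context: An exponential sum is a function $f:\mathbb{R}\to\mathbb{C}$ of the form $f(x)=\sum_{y\in Y}c_y e^{2\pi i yx}$ with $Y\subset[0,1)$ finite and $c_y\in\mathbb{C}\setminus\{0\}$. The set of all of these is $\mathcal{S}$. For $f\in\mathcal{S}$, $Y^f=Y$ is its set of frequencies and $c^f=(c^f_y)_{y\in Y^f}$ its coefficient vector. The wrap-around distance is $|y-y'|_{\mathbb{T}}=\min_{k\in\mathbb{Z}}|y-y'-k|$. For a finite $Y\subset[0,1)$, $\operatorname{sep}Y=\min_{y\ne y'\in Y}|y-y'|_{\mathbb{T}}$ (a condition $\operatorname{sep}Y\ge r$ is vacuously satisfied if $Y$ has at most one element), and for $r>0$, $\mathcal{S}(r)=\{f\in\mathcal{S}:\operatorname{sep}Y^f\ge r\}$. The functions $f,g$ are fixed (deterministic); the probability is over the noise $\boldsymbol{\eta}$. *)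

theory Defs
  imports "HOL-Probability.Probability"
begin

definition exp_sum_rep :: "(real \<Rightarrow> complex) \<Rightarrow> real set \<Rightarrow> (real \<Rightarrow> complex) \<Rightarrow> bool" where
  "exp_sum_rep f Y c \<longleftrightarrow>
     finite Y \<and> Y \<subseteq> {0..<1} \<and> (\<forall>y\<in>Y. c y \<noteq> 0) \<and>
     (\<forall>x. f x = (\<Sum>y\<in>Y. c y * exp (2 * pi * \<i> * y * x)))"

definition exp_sums :: "(real \<Rightarrow> complex) set" where
  "exp_sums = {f. \<exists>Y c. exp_sum_rep f Y c}"

text \<open>A representation of an exponential sum is unique up to the values of the coefficient
  function outside the frequency set, which are normalised to zero; see \<open>exp_freqs_eq\<close> and
  \<open>exp_coeff_eq\<close> below.\<close>

definition exp_freqs :: "(real \<Rightarrow> complex) \<Rightarrow> real set" where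
  "exp_freqs f = (THE Y. \<exists>c. exp_sum_rep f Y c)"

definition exp_coeff :: "(real \<Rightarrow> complex) \<Rightarrow> real \<Rightarrow> complex" where
  "exp_coeff f = (THE c. exp_sum_rep f (exp_freqs f) c \<and> (\<forall>y. y \<notin> exp_freqs f \<longrightarrow> c y = 0))"

definition wrap_dist :: "real \<Rightarrow> real \<Rightarrow> real" where
  "wrap_dist y y' = (INF k::int. \<bar>y - y' - of_int k\<bar>)"

text \<open>The infimum over the empty set is \<open>\<infinity>\<close>, so a bound \<open>sep Y \<ge> r\<close> is vacuous when \<open>Y\<close> has
  at most one element.\<close>

definition sep :: "real set \<Rightarrow> ereal" where
  "sep Y = (INF (y, y') \<in> {(y, y'). y \<in> Y \<and> y' \<in> Y \<and> y \<noteq> y'}. ereal (wrap_dist y y'))"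

definition separated_exp_sums :: "real \<Rightarrow> (real \<Rightarrow> complex) set" where
  "separated_exp_sums r = {f \<in> exp_sums. sep (exp_freqs f) \<ge> ereal r}"

lemma wrap_dist_attained: "\<exists>k::int. wrap_dist y y' = \<bar>y - y' - of_int k\<bar>"
proof -
  have le: "\<bar>y - y' - of_int (round (y - y'))\<bar> \<le> \<bar>y - y' - of_int k\<bar>" for k :: int
    using round_diff_minimal[of "y - y'" k] by (simp add: abs_minus_commute)
  have "wrap_dist y y' = \<bar>y - y' - of_int (round (y - y'))\<bar>"
    unfolding wrap_dist_def
    by (intro cInf_eq_minimum) (use le in auto)
  then show ?thesis by blast
qed

lemma exp_two_pi_i_inj:
  fixes y z :: real
  assumes "y \<in> {0..<1}" "z \<in> {0..<1}" "exp (2 * pi * \<i> * y) = exp (2 * pi * \<i> * z)"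
  shows "y = z"
proof -
  obtain n :: int where n: "2 * pi * \<i> * y = 2 * pi * \<i> * z + (of_int (2 * n) * pi) * \<i>"
    using assms(3) unfolding exp_eq by blast
  have "2 * pi * y = 2 * pi * z + 2 * of_int n * pi"
    using arg_cong[OF n, of Im] by simp
  then have "2 * pi * (y - z - of_int n) = 0"
    by (simp add: algebra_simps)
  then have e: "y - z = of_int n" by simp
  have "\<bar>y - z\<bar> < 1" using assms(1,2) by auto
  with e have "n = 0" by linarith
  with e show ?thesis by simp
qed

lemma exp_sum_zero:
  fixes Y :: "real set" and c :: "real \<Rightarrow> complex"
  assumes "finite Y" "Y \<subseteq> {0..<1}"
    and "\<And>x::real. (\<Sum>y\<in>Y. c y * exp (2 * pi * \<i> * y * x)) = 0" "y \<in> Y"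
  shows "c y = 0"
  using assms
proof (induction Y arbitrary: c y rule: finite_induct)
  case empty
  then show ?case by simp
next
  case (insert z Y)
  define e where "e = (\<lambda>y::real. exp (2 * pi * \<i> * y))"
  have shift: "exp (2 * pi * \<i> * y * (x + 1)) = e y * exp (2 * pi * \<i> * y * x)" for x y :: real
    by (simp add: e_def exp_add[symmetric] algebra_simps)
  have "(\<Sum>y\<in>Y. (c y * (e y - e z)) * exp (2 * pi * \<i> * y * x)) = 0" for x :: real
  proof -
    have "0 = (\<Sum>y\<in>insert z Y. c y * exp (2 * pi * \<i> * y * (x + 1)))
          - e z * (\<Sum>y\<in>insert z Y. c y * exp (2 * pi * \<i> * y * x))"
      using insert.prems(2)[of "x + 1"] insert.prems(2)[of x] by simp
    also have "\<dots> = (\<Sum>y\<in>insert z Y. (c y * (e y - e z)) * exp (2 * pi * \<i> * y * x))"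
      unfolding shift sum_distrib_left sum_subtractf[symmetric]
      by (intro sum.cong) (simp_all add: algebra_simps)
    also have "\<dots> = (\<Sum>y\<in>Y. (c y * (e y - e z)) * exp (2 * pi * \<i> * y * x))"
      using insert.hyps by simp
    finally show ?thesis by simp
  qed
  then have *: "c u * (e u - e z) = 0" if "u \<in> Y" for u
    using insert.IH[of "\<lambda>y. c y * (e y - e z)" u] insert.prems(1) that by auto
  have Y0: "c u = 0" if u: "u \<in> Y" for u
  proof -
    have "e u \<noteq> e z"
      using exp_two_pi_i_inj[of u z] insert.prems(1) insert.hyps(2) u by (auto simp: e_def)
    with *[OF u] show ?thesis by simp
  qed
  moreover have "c z = 0"
    using insert.prems(2)[of 0] insert.hyps Y0 by simp
  ultimately show ?case using insert.prems(3) by auto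
qed

lemma exp_sum_rep_unique:
  assumes "exp_sum_rep f Y c" "exp_sum_rep f Z d"
  shows "Y = Z" "y \<in> Y \<Longrightarrow> c y = d y"
proof -
  define c' where "c' = (\<lambda>y. if y \<in> Y then c y else 0)"
  define d' where "d' = (\<lambda>y. if y \<in> Z then d y else 0)"
  have fin: "finite Y" "finite Z" and sub: "Y \<union> Z \<subseteq> {0..<1}"
    and nz: "\<forall>y\<in>Y. c y \<noteq> 0" "\<forall>y\<in>Z. d y \<noteq> 0"
    using assms by (auto simp: exp_sum_rep_def)
  have fc: "f x = (\<Sum>y\<in>Y \<union> Z. c' y * exp (2 * pi * \<i> * y * x))" for x
  proof -
    have "f x = (\<Sum>y\<in>Y. c y * exp (2 * pi * \<i> * y * x))"
      using assms(1) unfolding exp_sum_rep_def by blast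
    also have "\<dots> = (\<Sum>y\<in>Y \<union> Z. c' y * exp (2 * pi * \<i> * y * x))"
      using fin by (intro sum.mono_neutral_cong_left) (auto simp: c'_def)
    finally show ?thesis .
  qed
  have fd: "f x = (\<Sum>y\<in>Y \<union> Z. d' y * exp (2 * pi * \<i> * y * x))" for x
  proof -
    have "f x = (\<Sum>y\<in>Z. d y * exp (2 * pi * \<i> * y * x))"
      using assms(2) unfolding exp_sum_rep_def by blast
    also have "\<dots> = (\<Sum>y\<in>Y \<union> Z. d' y * exp (2 * pi * \<i> * y * x))"
      using fin by (intro sum.mono_neutral_cong_left) (auto simp: d'_def)
    finally show ?thesis .
  qed
  have "(\<Sum>y\<in>Y \<union> Z. (c' y - d' y) * exp (2 * pi * \<i> * y * x)) = 0" for x :: real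
    using fc[of x] fd[of x] by (simp add: left_diff_distrib sum_subtractf)
  then have eq: "c' y = d' y" if "y \<in> Y \<union> Z" for y
    using exp_sum_zero[of "Y \<union> Z" "\<lambda>y. c' y - d' y" y] fin sub that by auto
  show YZ: "Y = Z"
  proof (intro equalityI subsetI)
    fix y assume "y \<in> Y"
    then show "y \<in> Z" using eq[of y] nz(1) by (auto simp: c'_def d'_def split: if_splits)
  next
    fix y assume "y \<in> Z"
    then show "y \<in> Y" using eq[of y] nz(2) by (auto simp: c'_def d'_def split: if_splits)
  qed
  show "c y = d y" if "y \<in> Y"
    using eq[of y] that YZ by (simp add: c'_def d'_def)
qed

lemma exp_freqs_eq:
  assumes "exp_sum_rep f Y c"
  shows "exp_freqs f = Y"
  unfolding exp_freqs_def
  by (rule the_equality) (use assms exp_sum_rep_unique(1) in blast)+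

lemma exp_coeff_eq:
  assumes "exp_sum_rep f Y c"
  shows "exp_coeff f y = (if y \<in> Y then c y else 0)"
proof -
  have Y: "exp_freqs f = Y" using assms by (rule exp_freqs_eq)
  have rep: "exp_sum_rep f Y (\<lambda>y. if y \<in> Y then c y else 0)"
    using assms by (simp add: exp_sum_rep_def)
  have "exp_coeff f = (\<lambda>y. if y \<in> Y then c y else 0)"
    unfolding exp_coeff_def Y
  proof (rule the_equality)
    show "exp_sum_rep f Y (\<lambda>y. if y \<in> Y then c y else 0) \<and>
        (\<forall>y. y \<notin> Y \<longrightarrow> (if y \<in> Y then c y else 0) = 0)"
      using rep by simp
  next
    fix d assume "exp_sum_rep f Y d \<and> (\<forall>y. y \<notin> Y \<longrightarrow> d y = 0)"
    then show "d = (\<lambda>y. if y \<in> Y then c y else 0)"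
      using exp_sum_rep_unique(2)[OF assms, of Y d] by (auto simp: fun_eq_iff)
  qed
  then show ?thesis by simp
qed

lemma exp_sum_rep_canonical:
  assumes "f \<in> exp_sums"
  shows "exp_sum_rep f (exp_freqs f) (exp_coeff f)"
proof -
  obtain Y c where r: "exp_sum_rep f Y c" using assms by (auto simp: exp_sums_def)
  have "exp_coeff f = (\<lambda>y. if y \<in> Y then c y else 0)"
    using exp_coeff_eq[OF r] by (simp add: fun_eq_iff)
  with r exp_freqs_eq[OF r] show ?thesis by (simp add: exp_sum_rep_def)
qed

end

theory Submission
  imports Defs
begin

text \<open>
  The difference \<open>h = f - g\<close> is itself an exponential sum: its point masses are the coefficients of \<open>f\<close>
  at the frequencies of \<open>f\<close> and the negated coefficients of \<open>g\<close> at those of \<open>g\<close>. The samples of \<open>h\<close> control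
  the masses through a minorant. Suppose real weights \<open>w m\<close> on the integers satisfy \<open>w m \<le> 1\<close> for
  \<open>\<bar>m\<bar> \<le> N\<close> and \<open>w m \<le> 0\<close> otherwise, and let \<open>\<phi>\<close> be the periodic function with Fourier coefficients \<open>w\<close>.
  Then the energy \<open>\<Sum>\<bar>m\<bar>\<le>N. \<bar>h m\<bar>\<^sup>2\<close> is at least \<open>\<Sum>m. w m * \<bar>h m\<bar>\<^sup>2\<close>, which is the quadratic form with
  matrix \<open>\<phi> (p i - p j)\<close> in the masses (\<open>minorant_quadratic_form_le\<close>). If moreover \<open>\<phi>\<close> vanishes at
  wrap-around distance \<open>3 / (2 * N + 2)\<close> and beyond, the separation of both frequency sets makes this
  matrix block diagonal: an unmatched frequency with coefficient \<open>c\<close> contributes \<open>\<phi> 0 * \<bar>c\<bar>\<^sup>2\<close>, and a pair at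
  distance \<open>t\<close> with coefficients \<open>c\<close>, \<open>d\<close> contributes
  \<open>(\<phi> 0 + \<phi> t) / 2 * \<bar>c - d\<bar>\<^sup>2 + (\<phi> 0 - \<phi> t) / 2 * \<bar>c + d\<bar>\<^sup>2\<close>. Lower bounds for the two factors give
  the two terms of the estimate. An unmatched frequency of \<open>f\<close> would already cost \<open>\<phi> 0 * c_min\<^sup>2\<close>, and
  \<open>\<phi> 0 \<ge> (4 * N + 4) / 3\<close> makes that exceed the available energy. This is \<open>frequency_stability\<close>.

  For \<open>N \<ge> 2\<close> such a \<open>\<phi>\<close> comes from Selberg's minorant of the indicator function of an interval
  (\<open>localising_kernel_exists\<close>). The weights may vanish at \<open>\<plusminus>(N + 1)\<close>, so the interval has length \<open>2 * N + 2\<close>;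
  minorants with Fourier transform supported in \<open>[-3 / (2 * N + 2), 3 / (2 * N + 2)]\<close> have integral at most
  \<open>2 * N + 2 - (2 * N + 2) / 3 = (4 * N + 4) / 3\<close>, and the Selberg function attains it. After rescaling,
  the interval has length 3 and the bandwidth is 1; as their product is an integer, the function and its
  transform are elementary.

  For the noise, expand \<open>\<parallel>h + \<eta>\<parallel>\<^sup>2 = \<parallel>h\<parallel>\<^sup>2 + 2 * \<langle>h, \<eta>\<rangle> + \<parallel>\<eta>\<parallel>\<^sup>2\<close>. Chernoff bounds for the lower tails of the
  Gaussian variable \<open>\<langle>h, \<eta>\<rangle>\<close> and of the chi-squared variable \<open>\<parallel>\<eta>\<parallel>\<^sup>2\<close> show that, outside an event whose
  probability is within the stated bound, \<open>\<parallel>h\<parallel>\<close> satisfies a quadratic inequality, and solving it gives \<open>\<parallel>h\<parallel>\<^sup>2 < R\<close>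
  (\<open>noise_norm_bound\<close>). That this inequality is strict excludes an unmatched frequency also in the
  threshold case \<open>R = (4 * N + 4) / 3 * c_min\<^sup>2\<close>.
\<close>

section \<open>The wrap-around distance\<close>

lemma wrap_dist_le: "wrap_dist y z \<le> \<bar>y - z - of_int k\<bar>"
  unfolding wrap_dist_def by (rule cINF_lower) (auto intro!: bdd_belowI2[of _ 0])

lemma wrap_dist_nonneg: "wrap_dist y z \<ge> 0"
  using wrap_dist_attained[of y z] by auto

lemma wrap_dist_diff: "wrap_dist y z = wrap_dist (y - z) 0"
  by (simp add: wrap_dist_def)

lemma wrap_dist_triangle: "wrap_dist x z \<le> wrap_dist x y + wrap_dist y z"
proof -
  obtain j k where j: "wrap_dist x y = \<bar>x - y - of_int j\<bar>" and k: "wrap_dist y z = \<bar>y - z - of_int k\<bar>"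
    using wrap_dist_attained by metis
  have "wrap_dist x z \<le> \<bar>x - z - of_int (j + k)\<bar>" by (rule wrap_dist_le)
  also have "\<dots> \<le> \<bar>x - y - of_int j\<bar> + \<bar>y - z - of_int k\<bar>" by simp
  finally show ?thesis using j k by simp
qed

lemma wrap_dist_commute: "wrap_dist x y = wrap_dist y x"
proof -
  have "wrap_dist x y \<le> wrap_dist y x" for x y
  proof -
    obtain k where "wrap_dist y x = \<bar>y - x - of_int k\<bar>" using wrap_dist_attained by blast
    then show ?thesis using wrap_dist_le[of x y "- k"] by simp
  qed
  then show ?thesis by (simp add: order_antisym)
qed

lemma wrap_dist_le_half: "wrap_dist y z \<le> 1 / 2"
  using wrap_dist_le[of y z "round (y - z)"] of_int_round_abs_le[of "y - z"]
  by (simp add: abs_minus_commute)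

lemma wrap_dist_zero_eq_abs:
  assumes "\<bar>t\<bar> \<le> 1 / 2"
  shows "wrap_dist t 0 = \<bar>t\<bar>"
proof (rule antisym)
  show "wrap_dist t 0 \<le> \<bar>t\<bar>" using wrap_dist_le[of t 0 0] by simp
  obtain k where k: "wrap_dist t 0 = \<bar>t - of_int k\<bar>" using wrap_dist_attained[of t 0] by auto
  show "\<bar>t\<bar> \<le> wrap_dist t 0"
  proof (cases "k = 0")
    case False
    then have "\<bar>of_int k :: real\<bar> \<ge> 1" by linarith
    with assms show ?thesis unfolding k by linarith
  qed (simp add: k)
qed

lemma continuous_on_wrap_dist: "continuous_on UNIV (\<lambda>t. wrap_dist t 0)"
proof (rule continuous_onI)
  fix x e :: real assume e: "e > 0"
  have "wrap_dist t 0 - wrap_dist x 0 \<le> \<bar>t - x\<bar>" for t x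
    using wrap_dist_triangle[of t 0 x] wrap_dist_le[of t x 0] by simp
  then have lip: "\<bar>wrap_dist t 0 - wrap_dist x 0\<bar> \<le> \<bar>t - x\<bar>" for t
    using abs_minus_commute[of t x] by (metis abs_le_iff minus_diff_eq)
  then show "\<exists>d>0. \<forall>x'\<in>UNIV. dist x' x < d \<longrightarrow> dist (wrap_dist x' 0) (wrap_dist x 0) \<le> e"
    using e unfolding dist_real_def by (intro exI[of _ e]) (metis lip less_imp_le order_trans)
qed

lemma wrap_dist_add_1: "wrap_dist (t + 1) 0 = wrap_dist t 0"
proof -
  have 1: "wrap_dist (t + 1) 0 \<le> wrap_dist t 0" for t
  proof -
    obtain k where "wrap_dist t 0 = \<bar>t - 0 - of_int k\<bar>" using wrap_dist_attained by blast
    then show ?thesis using wrap_dist_le[of "t + 1" 0 "k + 1"] by simp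
  qed
  have 2: "wrap_dist (t - 1) 0 \<le> wrap_dist t 0" for t
  proof -
    obtain k where "wrap_dist t 0 = \<bar>t - 0 - of_int k\<bar>" using wrap_dist_attained by blast
    then show ?thesis using wrap_dist_le[of "t - 1" 0 "k - 1"] by simp
  qed
  show ?thesis using 1[of t] 2[of "t + 1"] by simp
qed

lemma wrap_dist_minus: "wrap_dist (- t) 0 = wrap_dist t 0"
  using wrap_dist_commute[of 0 t] wrap_dist_diff[of 0 t] by simp

section \<open>The Selberg minorant of an interval of length three\<close>

lemma sin_duplication_inverse_square:
  fixes z :: real
  assumes "sin (pi * z) \<noteq> 0"
  shows "sin (pi * (z / 2)) \<noteq> 0" "sin (pi * ((z + 1) / 2)) \<noteq> 0"
    and "1 / (sin (pi * z))\<^sup>2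
      = (1 / (sin (pi * (z / 2)))\<^sup>2 + 1 / (sin (pi * ((z + 1) / 2)))\<^sup>2) / 4"
proof -
  have s: "sin (pi * z) = 2 * sin (pi * (z / 2)) * cos (pi * (z / 2))"
    using sin_double[of "pi * (z / 2)"] by simp
  have c: "sin (pi * ((z + 1) / 2)) = cos (pi * (z / 2))"
    using sin_add[of "pi * (z / 2)" "pi / 2"] by (simp add: algebra_simps add_divide_distrib)
  show 1: "sin (pi * (z / 2)) \<noteq> 0" and 2: "sin (pi * ((z + 1) / 2)) \<noteq> 0"
    using assms s c by auto
  show "1 / (sin (pi * z))\<^sup>2
      = (1 / (sin (pi * (z / 2)))\<^sup>2 + 1 / (sin (pi * ((z + 1) / 2)))\<^sup>2) / 4"
    using 1 2 sin_cos_squared_add[of "pi * (z / 2)"] unfolding s c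
    by (simp add: power_mult_distrib add_divide_eq_iff divide_add_eq_iff field_simps)
qed

lemma sum_split_parity:
  fixes h :: "nat \<Rightarrow> real"
  shows "(\<Sum>k<2 * n. h k) = (\<Sum>k<n. h (2 * k)) + (\<Sum>k<n. h (2 * k + 1))"
  by (induction n) auto

text \<open>A partial sum of the expansion of \<open>pi\<^sup>2 / (sin (pi * z))\<^sup>2\<close> into the terms \<open>1 / (z + k)\<^sup>2\<close>, for integers \<open>k\<close>.
  The duplication formula for the sine writes this function at \<open>z\<close> as a quarter of the sum of its values at
  \<open>z / 2\<close> and \<open>(z + 1) / 2\<close>, which doubles the number of terms; one term is the bound \<open>\<bar>sin u\<bar> \<le> \<bar>u\<bar>\<close>.\<close>

lemma inverse_square_sum_le:
  fixes z :: real
  assumes "sin (pi * z) \<noteq> 0"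
  shows "(\<Sum>k<2 ^ n. 1 / (z + real k)\<^sup>2) \<le> pi\<^sup>2 / (sin (pi * z))\<^sup>2"
  using assms
proof (induction n arbitrary: z)
  case 0
  have "\<bar>sin (pi * z)\<bar> \<le> \<bar>pi * z\<bar>" by (rule abs_sin_x_le_abs_x)
  then have "(sin (pi * z))\<^sup>2 \<le> pi\<^sup>2 * z\<^sup>2"
    by (metis abs_le_square_iff power_mult_distrib)
  moreover have "z \<noteq> 0" using 0 by auto
  ultimately show ?case using 0 by (simp add: field_simps)
next
  case (Suc n)
  note d = sin_duplication_inverse_square[OF Suc.prems]
  have half: "1 / (w / 2 + real k)\<^sup>2 = 4 * (1 / (w + real (2 * k))\<^sup>2)" for w k
  proof -
    have e: "w / 2 + real k = (w + real (2 * k)) / 2" by simp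
    show ?thesis unfolding e by (simp add: power_divide)
  qed
  have "(\<Sum>k<2 ^ Suc n. 1 / (z + real k)\<^sup>2)
      = (\<Sum>k<2 ^ n. 1 / (z + real (2 * k))\<^sup>2) + (\<Sum>k<2 ^ n. 1 / (z + 1 + real (2 * k))\<^sup>2)"
    unfolding power_Suc sum_split_parity by (simp add: algebra_simps)
  also have "\<dots> = ((\<Sum>k<2 ^ n. 1 / (z / 2 + real k)\<^sup>2)
                 + (\<Sum>k<2 ^ n. 1 / ((z + 1) / 2 + real k)\<^sup>2)) / 4"
    unfolding half sum_distrib_left[symmetric] by simp
  also have "\<dots> \<le> (pi\<^sup>2 / (sin (pi * (z / 2)))\<^sup>2 + pi\<^sup>2 / (sin (pi * ((z + 1) / 2)))\<^sup>2) / 4"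
    by (intro divide_right_mono add_mono Suc.IH d) simp
  also have "\<dots> = pi\<^sup>2 * (1 / (sin (pi * z))\<^sup>2)"
    unfolding d(3) by (simp add: algebra_simps)
  finally show ?case by simp
qed

text \<open>This is the inequality that makes the Selberg function at most 1 on its interval. Expand the right-hand
  side into the double poles at the half-integers. The poles at \<open>\<plusminus>1 / 2\<close> occur on both sides. On the left the
  others are replaced by two simple poles with factor \<open>2 / 3\<close>: the one at \<open>3 / 2\<close> is below the double pole
  there because \<open>3 / 2 - x \<le> 3 / 2\<close>, and the one at \<open>-3 / 2\<close> is below the sum over the first six double poles at
  \<open>-3 / 2, -5 / 2, \<dots>\<close>, by telescoping.\<close>

lemma selberg_poles_le:
  fixes x :: real
  assumes x: "0 \<le> x" "x < 3 / 2" "x \<noteq> 1 / 2"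
  shows "1 / (x + 1/2)\<^sup>2 + 1 / (x - 1/2)\<^sup>2 + 2/3 * (1 / (3/2 + x) + 1 / (3/2 - x))
      \<le> pi\<^sup>2 / (cos (pi * x))\<^sup>2" (is "?l \<le> ?r")
    and "cos (pi * x) \<noteq> 0"
proof -
  show c: "cos (pi * x) \<noteq> 0"
  proof
    assume "cos (pi * x) = 0"
    then obtain i :: int where i: "pi * x = of_int i * (pi / 2)" "odd i"
      unfolding cos_zero_iff_int by blast
    then have "x = of_int i / 2" by (simp add: field_simps)
    with x have "of_int i < (3::real)" "0 \<le> (of_int i::real)" "i \<noteq> 1" by auto
    then have "0 \<le> i" "i < 3" "i \<noteq> 1" by linarith+
    with \<open>odd i\<close> show False by presburger
  qed
  \<comment> \<open>The shift by 8 centres sixteen consecutive terms: those with \<open>k = 6, 7, 8\<close> are the double poles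
    at \<open>3 / 2\<close>, \<open>1 / 2\<close>, \<open>-1 / 2\<close>, and \<open>k = 9, \<dots>, 14\<close> are the six that follow on the negative side.\<close>
  define z where "z = x + 1/2 - 8"
  have s: "sin (pi * z) = cos (pi * x)"
  proof -
    have "pi * z = (pi * x + pi / 2) - of_int 8 * pi" by (simp add: z_def algebra_simps)
    then show ?thesis
      using sin_add[of "pi * x" "pi/2"] sin_diff[of "pi * x + pi / 2" "of_int 8 * pi"] by simp
  qed
  define b where "b = x + 3/2"
  have b: "3/2 \<le> b" "b \<le> 3" using x by (auto simp: b_def)
  have tail: "2 / (3 * b) \<le> (\<Sum>k<6. 1 / (b + real k)\<^sup>2)"
  proof -
    have tel: "1 / b - 1 / (b + real K) \<le> (\<Sum>k<K. 1 / (b + real k)\<^sup>2)" for K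
    proof (induction K)
      case (Suc K)
      have p: "b + real K > 0" using b by linarith
      have "1 / (b + real K) - 1 / (b + real (Suc K)) = 1 / ((b + real K) * (b + real K + 1))"
        using p by (simp add: field_simps)
      also have "\<dots> \<le> 1 / (b + real K)\<^sup>2"
        using p by (intro divide_left_mono) (auto simp: power2_eq_square)
      finally show ?case using Suc by simp
    qed simp
    have "2 / 3 \<le> 6 / (b + 6)" using b by (simp add: field_simps)
    then have "2 / 3 / b \<le> 6 / (b + 6) / b" using b by (intro divide_right_mono) auto
    also have "\<dots> = 1 / b - 1 / (b + real 6)" using b by (simp add: field_simps)
    finally have "2 / (3 * b) \<le> 1 / b - 1 / (b + real 6)" by simp
    with tel[of 6] show ?thesis by linarith
  qed
  have near: "2/3 * (1 / (3/2 - x)) \<le> 1 / (x - 3/2)\<^sup>2"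
  proof -
    have "2/3 * (1 / a) \<le> 1 / a\<^sup>2" if "0 < a" "a \<le> 3/2" for a :: real
      using that by (simp add: field_simps power2_eq_square)
    from this[of "3/2 - x"] x show ?thesis by (simp add: power2_commute)
  qed
  have "(\<Sum>k\<in>{6..<15}. 1 / (z + real k)\<^sup>2) \<le> (\<Sum>k<2 ^ 4. 1 / (z + real k)\<^sup>2)"
    by (intro sum_mono2) auto
  also have "\<dots> \<le> ?r"
    using inverse_square_sum_le[of z 4] c s by simp
  also have "{6..<15} = {6::nat, 7, 8} \<union> {9..<15}" by auto
  also have "(\<Sum>k\<in>\<dots>. 1 / (z + real k)\<^sup>2)
      = 1 / (x - 3/2)\<^sup>2 + 1 / (x - 1/2)\<^sup>2 + 1 / (x + 1/2)\<^sup>2 + (\<Sum>k\<in>{9..<15}. 1 / (z + real k)\<^sup>2)"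
    by (subst sum.union_disjoint) (auto simp: z_def algebra_simps)
  also have "(\<Sum>k\<in>{9..<15}. 1 / (z + real k)\<^sup>2) = (\<Sum>k<6. 1 / (b + real k)\<^sup>2)"
    by (rule sum.reindex_bij_witness[of _ "\<lambda>k. k + 9" "\<lambda>k. k - 9"])
       (auto simp: z_def b_def algebra_simps of_nat_diff)
  finally show "?l \<le> ?r"
    using tail near by (simp add: b_def algebra_simps)
qed

text \<open>The Fourier transform, on \<open>[0, 1]\<close>, of the even function
  \<open>(cos (pi * x) / pi)\<^sup>2 * (1 / (x - 1/2)\<^sup>2 + 1 / (x + 1/2)\<^sup>2 - 2/3 * (1 / (x - 3/2) - 1 / (x + 3/2)))\<close>.
  The double poles make that function take the value 1 at \<open>\<plusminus>1 / 2\<close> with derivative zero; the simple poles let it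
  change sign at \<open>\<plusminus>3 / 2\<close>, and their coefficient \<open>2 / 3\<close> cancels the leading order at infinity, so that the
  transform has no corner at 0.\<close>

definition selberg_transform :: "real \<Rightarrow> real" where
  "selberg_transform s = 2 * (1 - s) * cos (pi * s) + 2 / (3 * pi) * sin (3 * pi * s)"

lemma has_integral_ramp_cos:
  fixes \<alpha> :: real
  shows "((\<lambda>s. (1 - s) * cos (\<alpha> * s)) has_integral
            (if \<alpha> = 0 then 1 / 2 else (1 - cos \<alpha>) / \<alpha>\<^sup>2)) {0..1}"
proof (cases "\<alpha> = 0")
  case True
  have "((\<lambda>s. 1 - s) has_integral ((1 - 1\<^sup>2/2) - (0 - 0\<^sup>2/2))) {0..1::real}"
    by (rule fundamental_theorem_of_calculus)
       (auto intro!: derivative_eq_intros simp: has_real_derivative_iff_has_vector_derivative[symmetric])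
  with True show ?thesis by simp
next
  case False
  define G where "G = (\<lambda>s. (1 - s) * sin (\<alpha> * s) / \<alpha> - cos (\<alpha> * s) / \<alpha>\<^sup>2)"
  have "((\<lambda>s. (1 - s) * cos (\<alpha> * s)) has_integral (G 1 - G 0)) {0..1}"
    unfolding G_def using False
    by (intro fundamental_theorem_of_calculus)
       (auto intro!: derivative_eq_intros
         simp: has_real_derivative_iff_has_vector_derivative[symmetric] field_simps power2_eq_square)
  with False show ?thesis by (simp add: G_def diff_divide_distrib)
qed

lemma has_integral_sin:
  fixes \<beta> :: real
  shows "((\<lambda>s. sin (\<beta> * s)) has_integral (1 - cos \<beta>) / \<beta>) {0..1}"
proof (cases "\<beta> = 0")
  case False
  have "((\<lambda>s. sin (\<beta> * s)) has_integral (- cos (\<beta> * 1) / \<beta> - (- cos (\<beta> * 0) / \<beta>))) {0..1}"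
    using False by (intro fundamental_theorem_of_calculus)
       (auto intro!: derivative_eq_intros
         simp: has_real_derivative_iff_has_vector_derivative[symmetric])
  then show ?thesis by (simp add: diff_divide_distrib)
qed simp

definition selberg_minorant :: "real \<Rightarrow> real" where
  "selberg_minorant x = 2 * integral {0..1} (\<lambda>s. selberg_transform s * cos (2 * pi * x * s))"

text \<open>Product formulas split the integrand into two terms \<open>(1 - s) * cos (\<alpha> * s)\<close> and two terms \<open>sin (\<beta> * s)\<close>.
  Since \<open>\<alpha>\<close> and \<open>\<beta>\<close> differ from \<open>\<plusminus>2 * pi * x\<close> by odd multiples of \<open>pi\<close>, all four integrals contain the same
  factor \<open>1 - cos \<alpha> = 2 * (cos (pi * x))\<^sup>2\<close>. The formula also covers \<open>x = 3 / 2\<close>, where division by zero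
  returns the value 0 that the integral of \<open>sin 0\<close> has; at \<open>x = 1 / 2\<close> one of the ramp integrals degenerates.\<close>

lemma selberg_minorant_closed_form:
  shows "x \<noteq> 1 / 2 \<Longrightarrow> x \<ge> 0 \<Longrightarrow> selberg_minorant x = (cos (pi * x))\<^sup>2 / pi\<^sup>2 *
     (1 / (x + 1/2)\<^sup>2 + 1 / (x - 1/2)\<^sup>2 + 2/3 * (1 / (3/2 + x) + 1 / (3/2 - x)))"
  and "selberg_minorant (1/2) = 1"
proof -
  define C where "C = (\<lambda>\<alpha>::real. if \<alpha> = 0 then 1 / 2 else (1 - cos \<alpha>) / \<alpha>\<^sup>2)"
  define S where "S = (\<lambda>\<beta>::real. (1 - cos \<beta>) / \<beta>)"
  have split: "selberg_transform s * cos (2 * pi * x * s)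
      = ((1 - s) * cos ((2 * x + 1) * pi * s) + (1 - s) * cos ((2 * x - 1) * pi * s))
        + 1 / (3 * pi) * (sin ((3 + 2 * x) * pi * s) + sin ((3 - 2 * x) * pi * s))" for x s
  proof -
    have 1: "cos ((2 * x + 1) * pi * s) + cos ((2 * x - 1) * pi * s)
        = 2 * cos (pi * s) * cos (2 * pi * x * s)"
      using cos_add[of "2 * pi * x * s" "pi * s"] cos_diff[of "2 * pi * x * s" "pi * s"]
      by (simp add: algebra_simps)
    have 2: "sin ((3 + 2 * x) * pi * s) + sin ((3 - 2 * x) * pi * s)
        = 2 * sin (3 * pi * s) * cos (2 * pi * x * s)"
      using sin_add[of "3 * pi * s" "2 * pi * x * s"] sin_diff[of "3 * pi * s" "2 * pi * x * s"]
      by (simp add: algebra_simps)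
    show ?thesis
      unfolding distrib_left[of "1 - s", symmetric] 1 2 selberg_transform_def by (simp add: algebra_simps)
  qed
  have val: "selberg_minorant x = 2 * (C ((2 * x + 1) * pi) + C ((2 * x - 1) * pi)
       + 1 / (3 * pi) * (S ((3 + 2 * x) * pi) + S ((3 - 2 * x) * pi)))" for x
  proof -
    have "((\<lambda>s. selberg_transform s * cos (2 * pi * x * s)) has_integral
       (C ((2 * x + 1) * pi) + C ((2 * x - 1) * pi)
       + 1 / (3 * pi) * (S ((3 + 2 * x) * pi) + S ((3 - 2 * x) * pi)))) {0..1}"
      unfolding split C_def S_def
      by (intro has_integral_add has_integral_mult_right has_integral_ramp_cos has_integral_sin)
    then show ?thesis unfolding selberg_minorant_def by (simp add: integral_unique)
  qed
  have cosp: "1 - cos ((2 * x + 1) * pi) = 2 * (cos (pi * x))\<^sup>2"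
             "1 - cos ((2 * x - 1) * pi) = 2 * (cos (pi * x))\<^sup>2"
             "1 - cos ((3 + 2 * x) * pi) = 2 * (cos (pi * x))\<^sup>2"
             "1 - cos ((3 - 2 * x) * pi) = 2 * (cos (pi * x))\<^sup>2"
  proof -
    have d: "2 * (cos (pi * x))\<^sup>2 = 1 + cos (2 * pi * x)"
      using cos_double_cos[of "pi * x"] by (simp add: algebra_simps)
    have sh: "cos (u + 3 * pi) = - cos u" for u
      using cos_periodic_pi[of "u + 2 * pi"] cos_periodic[of u] by (simp add: algebra_simps)
    show "1 - cos ((2 * x + 1) * pi) = 2 * (cos (pi * x))\<^sup>2"
      using cos_periodic_pi[of "2 * pi * x"] d by (simp add: algebra_simps)
    show "1 - cos ((2 * x - 1) * pi) = 2 * (cos (pi * x))\<^sup>2"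
      using cos_diff[of "2 * pi * x" pi] d by (simp add: algebra_simps)
    show "1 - cos ((3 + 2 * x) * pi) = 2 * (cos (pi * x))\<^sup>2"
      using sh[of "2 * pi * x"] d by (simp add: algebra_simps)
    show "1 - cos ((3 - 2 * x) * pi) = 2 * (cos (pi * x))\<^sup>2"
      using sh[of "- (2 * pi * x)"] d by (simp add: algebra_simps)
  qed
  have C: "C ((2 * x + 1) * pi) = (cos (pi * x))\<^sup>2 / pi\<^sup>2 / 2 * (1 / (x + 1/2)\<^sup>2)"
          "C ((2 * x - 1) * pi) = (cos (pi * x))\<^sup>2 / pi\<^sup>2 / 2 * (1 / (x - 1/2)\<^sup>2)"
    if "x \<noteq> 1 / 2" "x \<ge> 0"
  proof -
    have e: "(2 * x + 1) * pi = 2 * pi * (x + 1/2)" "(2 * x - 1) * pi = 2 * pi * (x - 1/2)"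
      by (simp_all add: algebra_simps)
    have "(2 * x + 1) * pi \<noteq> 0" "(2 * x - 1) * pi \<noteq> 0" using that by auto
    then show "C ((2 * x + 1) * pi) = (cos (pi * x))\<^sup>2 / pi\<^sup>2 / 2 * (1 / (x + 1/2)\<^sup>2)"
          "C ((2 * x - 1) * pi) = (cos (pi * x))\<^sup>2 / pi\<^sup>2 / 2 * (1 / (x - 1/2)\<^sup>2)"
      unfolding C_def cosp unfolding e by (simp_all add: power_mult_distrib)
  qed
  have S: "S ((3 + 2 * x) * pi) = (cos (pi * x))\<^sup>2 / pi * (1 / (3/2 + x))"
          "S ((3 - 2 * x) * pi) = (cos (pi * x))\<^sup>2 / pi * (1 / (3/2 - x))"
  proof -
    have e: "(3 + 2 * x) * pi = 2 * pi * (3/2 + x)" "(3 - 2 * x) * pi = 2 * pi * (3/2 - x)"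
      by (simp_all add: algebra_simps)
    show "S ((3 + 2 * x) * pi) = (cos (pi * x))\<^sup>2 / pi * (1 / (3/2 + x))"
          "S ((3 - 2 * x) * pi) = (cos (pi * x))\<^sup>2 / pi * (1 / (3/2 - x))"
      unfolding S_def cosp unfolding e by simp_all
  qed
  have collect: "2 * (c / p\<^sup>2 / 2 * P + c / p\<^sup>2 / 2 * Q + 1 / (3 * p) * (c / p * U + c / p * V))
      = c / p\<^sup>2 * (P + Q + 2/3 * (U + V))" for c p P Q U V :: real
    by (simp add: algebra_simps power2_eq_square)
  show "selberg_minorant x = (cos (pi * x))\<^sup>2 / pi\<^sup>2 *
     (1 / (x + 1/2)\<^sup>2 + 1 / (x - 1/2)\<^sup>2 + 2/3 * (1 / (3/2 + x) + 1 / (3/2 - x)))"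
    if "x \<noteq> 1 / 2" "x \<ge> 0"
    unfolding val C[OF that] S by (rule collect)
  have "cos (4 * pi) = 1" using cos_npi2[of 4] by (simp add: mult.commute)
  then show "selberg_minorant (1/2) = 1"
    unfolding val by (simp add: C_def S_def)
qed

lemma selberg_minorant_le_1:
  assumes "0 \<le> x" "x < 3 / 2"
  shows "selberg_minorant x \<le> 1"
proof (cases "x = 1 / 2")
  case True
  then show ?thesis unfolding True selberg_minorant_closed_form(2) by simp
next
  case False
  have c: "cos (pi * x) \<noteq> 0" by (rule selberg_poles_le(2)[OF assms False])
  have "selberg_minorant x \<le> (cos (pi * x))\<^sup>2 / pi\<^sup>2 * (pi\<^sup>2 / (cos (pi * x))\<^sup>2)"
    unfolding selberg_minorant_closed_form(1)[OF False assms(1)]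
    by (intro mult_left_mono selberg_poles_le assms False) simp
  also have "\<dots> = 1" using c by simp
  finally show ?thesis .
qed

text \<open>In terms of \<open>u = x\<^sup>2\<close>, the double poles add up to \<open>(2 * u + 1/2) / (u - 1/4)\<^sup>2\<close> and the simple ones to
  \<open>- 2 / (u - 9/4)\<close>; cross-multiplication leaves a negative linear polynomial in \<open>u\<close>.\<close>

lemma selberg_minorant_nonpos:
  assumes "3 / 2 \<le> x"
  shows "selberg_minorant x \<le> 0"
proof (cases "x = 3 / 2")
  case True
  have "cos (pi * x) = 0" using True cos_zero_iff_int[of "pi * x"] by (auto intro!: exI[of _ 3])
  then show ?thesis using selberg_minorant_closed_form(1)[of x] assms by simp
next
  case False
  define u where "u = x\<^sup>2"
  have u: "u > 9/4" using False assms power_strict_mono[of "3/2" x 2]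
    by (simp add: u_def power2_eq_square)
  have e1: "1 / (x + 1/2)\<^sup>2 + 1 / (x - 1/2)\<^sup>2 = (2 * u + 1/2) / (u - 1/4)\<^sup>2"
  proof -
    have "x + 1/2 \<noteq> 0" "x - 1/2 \<noteq> 0" using assms by auto
    then have "1 / (x + 1/2)\<^sup>2 + 1 / (x - 1/2)\<^sup>2
       = ((x - 1/2)\<^sup>2 + (x + 1/2)\<^sup>2) / ((x + 1/2) * (x - 1/2))\<^sup>2"
      by (simp add: add_frac_eq power_mult_distrib)
    also have "(x + 1/2) * (x - 1/2) = u - 1/4"
      by (simp add: u_def power2_eq_square algebra_simps)
    also have "(x - 1/2)\<^sup>2 + (x + 1/2)\<^sup>2 = 2 * u + 1/2"
      by (simp add: u_def power2_eq_square algebra_simps)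
    finally show ?thesis .
  qed
  have e2: "2/3 * (1 / (3/2 + x) + 1 / (3/2 - x)) = - (2 / (u - 9/4))"
  proof -
    have n: "3/2 + x \<noteq> 0" "3/2 - x \<noteq> 0" using assms False by auto
    then have "2/3 * (1 / (3/2 + x) + 1 / (3/2 - x)) = 2 / ((3/2 + x) * (3/2 - x))"
      by (simp add: add_frac_eq)
    also have "(3/2 + x) * (3/2 - x) = - (u - 9/4)"
      by (simp add: u_def power2_eq_square algebra_simps)
    finally show ?thesis by (simp only: minus_divide_right)
  qed
  have "(2 * u + 1/2) / (u - 1/4)\<^sup>2 \<le> 2 / (u - 9/4)"
  proof -
    have "(2 * u + 1/2) * (u - 9/4) \<le> 2 * (u - 1/4)\<^sup>2"
      using u by (simp add: power2_eq_square algebra_simps)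
    then show ?thesis using u by (simp add: frac_le_eq divide_le_eq le_divide_eq field_simps)
  qed
  then have "1 / (x + 1/2)\<^sup>2 + 1 / (x - 1/2)\<^sup>2 + 2/3 * (1 / (3/2 + x) + 1 / (3/2 - x)) \<le> 0"
    unfolding e1 e2 by simp
  moreover have half: "x \<noteq> 1 / 2" and nonneg: "x \<ge> 0" using assms by auto
  ultimately show ?thesis
    unfolding selberg_minorant_closed_form(1)[OF half nonneg] by (intro mult_nonneg_nonpos) auto
qed

text \<open>The constant 18 is far from optimal, but it is the one that produces the factor \<open>2 * pi\<^sup>2 / 3 ^ 5\<close> of the
  stability estimate. It amounts to \<open>sin h \<ge> h / 3\<close> for the half angle \<open>h\<close>.\<close>

lemma one_minus_cos_ge:
  fixes a :: real
  assumes "\<bar>a\<bar> \<le> pi"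
  shows "1 - cos a \<ge> a\<^sup>2 / 18"
proof -
  define h where "h = \<bar>a\<bar> / 2"
  have h: "0 \<le> h" "h \<le> pi / 2" using assms by (auto simp: h_def)
  have "h \<le> 2" using h pi_less_4 by linarith
  have "h / 3 \<le> sin h"
  proof -
    have "h - h ^ 3 / 6 \<le> sin h"
    proof -
      have "\<bar>sin h - (\<Sum>m<3. sin_coeff m * h ^ m)\<bar> \<le> inverse (fact 3) * \<bar>h\<bar> ^ 3"
        by (rule Maclaurin_sin_bound)
      moreover have "(\<Sum>m<3. sin_coeff m * h ^ m) = h"
        by (simp add: numeral_3_eq_3 sin_coeff_def)
      moreover have "inverse (fact 3) * \<bar>h\<bar> ^ 3 = h ^ 3 / 6"
        using h by (simp add: fact_numeral)
      ultimately show ?thesis by linarith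
    qed
    moreover have "h ^ 3 \<le> h * 4"
      using mult_left_mono[of "h * h" "2 * 2" h] mult_mono[of h 2 h 2] h \<open>h \<le> 2\<close>
      by (simp add: power3_eq_cube mult.assoc)
    ultimately show ?thesis by linarith
  qed
  then have "(h / 3)\<^sup>2 \<le> (sin h)\<^sup>2" using h by (intro power_mono) auto
  moreover have "1 - cos a = 2 * (sin h)\<^sup>2"
    using cos_double_sin[of h] by (simp add: h_def)
  moreover have "a\<^sup>2 / 18 = 2 * (h / 3)\<^sup>2" by (simp add: h_def power_divide)
  ultimately show ?thesis by simp
qed

text \<open>The left-hand side is the integral of \<open>t * sin t\<close> over \<open>[0, a]\<close> and \<open>1 - cos a\<close> that of \<open>sin t\<close>, so their
  quotient is a weighted mean of \<open>t\<close>, which increases with \<open>a\<close> up to \<open>pi / 2\<close> at \<open>a = pi\<close>. In terms of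
  \<open>b = a - pi / 2\<close> the claim is that the even function \<open>cos b + b * sin b\<close> is at most its value at \<open>\<plusminus>pi / 2\<close>.\<close>

lemma sin_minus_mult_cos_le:
  fixes a :: real
  assumes "0 \<le> a" "a \<le> pi"
  shows "sin a - a * cos a \<le> pi / 2 * (1 - cos a)"
proof -
  have G: "cos b + b * sin b \<le> pi / 2" if b: "0 \<le> b" "b \<le> pi / 2" for b :: real
  proof -
    have "cos b + b * sin b \<le> cos (pi / 2) + pi / 2 * sin (pi / 2)"
    proof (rule DERIV_nonneg_imp_nondecreasing[OF b(2)])
      fix x assume x: "b \<le> x" "x \<le> pi / 2"
      have "((\<lambda>b. cos b + b * sin b) has_real_derivative x * cos x) (at x)"
        by (auto intro!: derivative_eq_intros)
      moreover have "0 \<le> x * cos x" using x b by (intro mult_nonneg_nonneg cos_ge_zero) auto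
      ultimately show "\<exists>y. ((\<lambda>b. cos b + b * sin b) has_real_derivative y) (at x) \<and> 0 \<le> y"
        by blast
    qed
    then show ?thesis by simp
  qed
  have "cos (a - pi / 2) + (a - pi / 2) * sin (a - pi / 2) \<le> pi / 2"
  proof (cases "a \<ge> pi / 2")
    case True
    then show ?thesis using G[of "a - pi / 2"] assms by simp
  next
    case False
    then have "cos (pi / 2 - a) + (pi / 2 - a) * sin (pi / 2 - a) \<le> pi / 2"
      using G[of "pi / 2 - a"] assms by simp
    then show ?thesis
      using sin_minus[of "pi / 2 - a"] cos_minus[of "pi / 2 - a"] by (simp add: algebra_simps)
  qed
  then show ?thesis by (simp add: cos_diff sin_diff algebra_simps)
qed

text \<open>The triple-angle formula turns the left-hand side, at \<open>a = pi * s\<close>, into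
  \<open>2 * (1 - cos a) - 2 / pi * (sin a - a * cos a)\<close> plus a nonnegative multiple of \<open>(sin a)\<^sup>3\<close>, and the second term is
  at most half of the first.\<close>

lemma two_minus_selberg_transform_ge:
  assumes "0 \<le> s" "s \<le> 1"
  shows "2 - selberg_transform s \<ge> pi\<^sup>2 * s\<^sup>2 / 18"
proof -
  define a where "a = pi * s"
  have a: "0 \<le> a" "a \<le> pi" using assms by (auto simp: a_def mult_left_le)
  have "sin (3 * a) = 3 * sin a - 4 * sin a ^ 3" 
  proof -
    have "sin (3 * a) = sin (2 * a) * cos a + cos (2 * a) * sin a"
      using sin_add[of "2 * a" a] by simp
    also have "\<dots> = 2 * sin a * (cos a)\<^sup>2 + (1 - 2 * (sin a)\<^sup>2) * sin a"
      unfolding sin_double cos_double_sin by (simp add: power2_eq_square)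
    also have "\<dots> = 3 * sin a - 4 * sin a ^ 3"
      unfolding cos_squared_eq by (simp add: algebra_simps power2_eq_square power3_eq_cube)
    finally show ?thesis .
  qed
  moreover have "selberg_transform s = 2 * (1 - a / pi) * cos a + 2 / (3 * pi) * sin (3 * a)"
    by (simp add: selberg_transform_def a_def mult.assoc)
  ultimately have "2 - selberg_transform s = 2 * (1 - cos a) - 2 / pi * (sin a - a * cos a) + 8 / (3 * pi) * sin a ^ 3"
    by (simp add: field_simps)
  moreover have "2 / pi * (sin a - a * cos a) \<le> 1 - cos a"
  proof -
    have "2 / pi * (sin a - a * cos a) \<le> 2 / pi * (pi / 2 * (1 - cos a))"
      by (intro mult_left_mono sin_minus_mult_cos_le a) auto
    also have "\<dots> = 1 - cos a" by simp
    finally show ?thesis .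
  qed
  moreover have "8 / (3 * pi) * sin a ^ 3 \<ge> 0" using a by (simp add: sin_ge_zero)
  moreover have "1 - cos a \<ge> a\<^sup>2 / 18" using a by (intro one_minus_cos_ge) simp
  moreover have "d \<le> x" if "x = 2 * c - T + U" "T \<le> c" "0 \<le> U" "d \<le> c" for x c T U d :: real
    using that by linarith
  ultimately have "2 - selberg_transform s \<ge> a\<^sup>2 / 18" by blast
  then show ?thesis by (simp add: a_def power_mult_distrib)
qed

lemma selberg_transform_ge:
  assumes "0 \<le> s" "s \<le> 1"
  shows "selberg_transform s \<ge> - 1"
proof -
  have "(1 - s) * cos (pi * s) \<ge> - (1 / 4)"
  proof (cases "s \<le> 1 / 2")
    case True
    then have "pi * s \<le> pi / 2" "0 \<le> pi * s" using assms by auto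
    then have "cos (pi * s) \<ge> 0" using pi_gt_zero by (intro cos_ge_zero) linarith+
    then have "(1 - s) * cos (pi * s) \<ge> 0" using assms by simp
    then show ?thesis by linarith
  next
    case False
    define r where "r = 1 - s"
    have r: "0 \<le> r" "r < 1 / 2" using False assms by (auto simp: r_def)
    have "cos (pi * s) = - sin (pi * (1 / 2 - r))"
      using sin_diff[of "pi / 2" "pi * r"] cos_diff[of pi "pi * r"] by (simp add: r_def algebra_simps)
    moreover have "sin (pi * (1 / 2 - r)) \<le> pi * (1 / 2 - r)" using r by (intro sin_x_le_x) auto
    moreover have "pi * (1 / 2 - r) \<le> 4 * (1 / 2 - r)"
      using r pi_less_4 by (intro mult_right_mono) auto
    ultimately have "r * - cos (pi * s) \<le> r * (4 * (1 / 2 - r))"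
      using r by (intro mult_left_mono) auto
    also have "\<dots> \<le> 1 / 4"
      using zero_le_power2[of "2 * r - 1 / 2"] by (simp add: power2_eq_square algebra_simps)
    finally show ?thesis by (simp add: r_def)
  qed
  moreover have "2 / (3 * pi) * sin (3 * pi * s) \<ge> - (1 / 2)"
  proof -
    have "2 / (3 * pi) * sin (3 * pi * s) \<ge> 2 / (3 * pi) * (- 1)"
      by (intro mult_left_mono) auto
    moreover have "2 / (3 * pi) \<le> 1 / 2" using pi_gt3 by (simp add: field_simps)
    ultimately show ?thesis by linarith
  qed
  ultimately show ?thesis unfolding selberg_transform_def by linarith
qed

lemma continuous_on_selberg_transform: "continuous_on A selberg_transform"
  unfolding selberg_transform_def by (intro continuous_intros)

lemma selberg_transform_0: "selberg_transform 0 = 2" and selberg_transform_1: "selberg_transform 1 = 0"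
proof -
  show "selberg_transform 0 = 2" by (simp add: selberg_transform_def)
  have "sin (3 * pi) = 0" using sin_npi2[of 3] by (simp add: mult.commute)
  then show "selberg_transform 1 = 0" by (simp add: selberg_transform_def)
qed

section \<open>Fejer means of a periodic function\<close>

text \<open>The usual weights \<open>1 - \<bar>m\<bar> / n\<close> are the numbers of pairs \<open>(j, l)\<close> with \<open>j - l = m\<close>, divided by \<open>n\<close>. Keeping the
  pairs avoids counting them.\<close>

definition fejer_kernel :: "nat \<Rightarrow> real \<Rightarrow> real" where
  "fejer_kernel n v = (\<Sum>j<n. \<Sum>l<n. cos (2 * pi * real_of_int (int j - int l) * v)) / real n"

lemma fejer_kernel_eq_square:
  "fejer_kernel n v = (cmod (\<Sum>j<n. cis (2 * pi * v) ^ j))\<^sup>2 / real n"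
proof -
  have "(cmod (\<Sum>j<n. cis (2 * pi * v) ^ j))\<^sup>2
      = Re ((\<Sum>j<n. cis (2 * pi * v) ^ j) * cnj (\<Sum>j<n. cis (2 * pi * v) ^ j))"
    by (simp add: complex_norm_square[symmetric] del: Re_sum cnj_sum)
  also have "\<dots> = (\<Sum>j<n. \<Sum>l<n. cos (2 * pi * real_of_int (int j - int l) * v))"
    unfolding cnj_sum sum_product Re_sum
    by (intro sum.cong refl)
       (simp add: Complex.DeMoivre cis_cnj cis_mult algebra_simps)
  finally show ?thesis by (simp add: fejer_kernel_def)
qed

lemma fejer_kernel_nonneg: "fejer_kernel n v \<ge> 0"
  unfolding fejer_kernel_eq_square by simp

lemma norm_cis_minus_1: "cmod (1 - cis (2 * x)) = 2 * \<bar>sin x\<bar>"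
proof -
  have "1 - cis (2 * x) = - 2 * \<i> * of_real (sin x) * cis x"
    by (simp add: complex_eq_iff cos_double_sin sin_double power2_eq_square)
  then show ?thesis by (simp add: norm_mult)
qed

lemma fejer_kernel_le:
  assumes "sin (pi * v) \<noteq> 0" "n > 0"
  shows "fejer_kernel n v \<le> 1 / (real n * (sin (pi * v))\<^sup>2)"
proof -
  define z where "z = cis (2 * pi * v)"
  have nz: "cmod (1 - z) = 2 * \<bar>sin (pi * v)\<bar>"
    using norm_cis_minus_1[of "pi * v"] by (simp add: z_def mult.assoc)
  with assms have "z \<noteq> 1" by auto
  then have "(\<Sum>j<n. z ^ j) = (1 - z ^ n) / (1 - z)"
    by (simp add: sum_gp_strict)
  then have "cmod (\<Sum>j<n. z ^ j) = cmod (1 - z ^ n) / (2 * \<bar>sin (pi * v)\<bar>)"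
    by (simp add: norm_divide nz)
  also have "\<dots> \<le> 2 / (2 * \<bar>sin (pi * v)\<bar>)"
  proof (intro divide_right_mono)
    show "cmod (1 - z ^ n) \<le> 2"
      using norm_triangle_ineq4[of 1 "z ^ n"] by (simp add: z_def norm_power)
  qed simp
  finally have "cmod (\<Sum>j<n. z ^ j) \<le> 1 / \<bar>sin (pi * v)\<bar>" by simp
  then have "(cmod (\<Sum>j<n. z ^ j))\<^sup>2 \<le> (1 / \<bar>sin (pi * v)\<bar>)\<^sup>2"
    by (intro power_mono) auto
  then show ?thesis
    unfolding fejer_kernel_eq_square z_def[symmetric] using assms
    by (simp add: power_divide divide_simps mult.commute)
qed

abbreviation unit_cell :: "real set" where "unit_cell \<equiv> {- (1/2)..1/2}"

lemma has_integral_cos_unit_cell: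
  fixes m :: int and t :: real
  shows "((\<lambda>u. cos (2 * pi * of_int m * (t - u))) has_integral (if m = 0 then 1 else 0)) unit_cell"
proof (cases "m = 0")
  case True
  then show ?thesis using has_integral_const_real[of "1::real" "- (1/2)" "1/2"] by simp
next
  case False
  define G where "G = (\<lambda>u. - sin (2 * pi * of_int m * (t - u)) / (2 * pi * of_int m))"
  have "((\<lambda>u. cos (2 * pi * of_int m * (t - u))) has_integral (G (1/2) - G (- (1/2)))) unit_cell"
    unfolding G_def using False
    by (intro fundamental_theorem_of_calculus)
       (auto intro!: derivative_eq_intros
         simp: has_real_derivative_iff_has_vector_derivative[symmetric])
  moreover have "sin (2 * pi * of_int m * (t + 1/2)) = sin (2 * pi * of_int m * (t - 1/2))"
  proof -
    have "2 * pi * of_int m * (t + 1/2) = 2 * pi * of_int m * (t - 1/2) + 2 * pi * of_int m"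
      by (simp add: algebra_simps)
    then show ?thesis using sin_add[of "2 * pi * of_int m * (t - 1/2)" "2 * pi * of_int m"] by simp
  qed
  ultimately show ?thesis using False by (simp add: G_def)
qed

lemma has_integral_fejer_kernel:
  assumes "n > 0"
  shows "((\<lambda>u. fejer_kernel n (t - u)) has_integral 1) unit_cell"
proof -
  have "((\<lambda>u. \<Sum>j<n. \<Sum>l<n. cos (2 * pi * real_of_int (int j - int l) * (t - u)))
      has_integral (\<Sum>j<n. \<Sum>l<n. if int j - int l = 0 then 1 else 0)) unit_cell"
    by (intro has_integral_sum finite_lessThan has_integral_cos_unit_cell)
  also have "(\<Sum>j<n. \<Sum>l<n. if int j - int l = 0 then 1 else 0 :: real) = real n"
    by (simp add: sum.delta)
  finally show ?thesis
    using has_integral_divide[of _ "real n" unit_cell "real n"] assms unfolding fejer_kernel_def by simp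
qed

lemma continuous_on_fejer_kernel: "continuous_on A (\<lambda>u. fejer_kernel n (t - u))"
  unfolding fejer_kernel_def divide_inverse by (intro continuous_intros)

text \<open>Subtract \<open>\<phi> t\<close> under the integral. Where \<open>u\<close> is close to \<open>t\<close> modulo 1, continuity makes the difference
  small and the kernel has total mass 1; elsewhere the sine is bounded away from 0, so the kernel is
  \<open>O(1 / n)\<close> uniformly. Working with \<open>u - t\<close> reduced modulo 1 avoids translating the integral over a period.\<close>

lemma fejer_means_tendsto:
  fixes \<phi> :: "real \<Rightarrow> real"
  assumes cont: "continuous_on UNIV \<phi>" and per: "\<And>u. \<phi> (u + 1) = \<phi> u"
  shows "(\<lambda>n. integral unit_cell (\<lambda>u. \<phi> u * fejer_kernel n (t - u))) \<longlonglongrightarrow> \<phi> t"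
proof (rule LIMSEQ_I)
  fix \<epsilon> :: real assume e: "\<epsilon> > 0"
  have per': "\<phi> (u + of_int k) = \<phi> u" for u k
  proof -
    have nat: "\<phi> (u + real m) = \<phi> u" for u m
    proof (induction m)
      case (Suc m)
      then show ?case using per[of "u + real m"] by (simp add: algebra_simps)
    qed simp
    show ?thesis
      using nat[of u "nat k"] nat[of "u + of_int k" "nat (- k)"] by (cases "k \<ge> 0") auto
  qed
  obtain d0 where d0: "d0 > 0" "\<And>u. \<bar>u - t\<bar> < d0 \<Longrightarrow> \<bar>\<phi> u - \<phi> t\<bar> < \<epsilon> / 2"
  proof -
    have "isCont \<phi> t" using cont by (simp add: continuous_on_eq_continuous_at)
    then obtain d where "d > 0" "\<And>u. dist u t < d \<Longrightarrow> dist (\<phi> u) (\<phi> t) < \<epsilon> / 2"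
      using e unfolding continuous_at_eps_delta by (elim allE[of _ "\<epsilon> / 2"]) auto
    then show ?thesis using that by (auto simp: dist_real_def)
  qed
  define d where "d = min d0 (1/2)"
  have d: "0 < d" "d \<le> 1/2" "d \<le> d0" using d0 by (auto simp: d_def)
  define s where "s = (sin (pi * d))\<^sup>2"
  have s: "s > 0"
    unfolding s_def using d sin_gt_zero[of "pi * d"] by (simp add: mult_less_cancel_left1) 
  have "compact (\<phi> ` unit_cell)"
    by (intro compact_continuous_image continuous_on_subset[OF cont]) auto
  then have "bounded (\<phi> ` unit_cell)" by (rule compact_imp_bounded)
  then obtain B where B: "B > 0" "\<And>u. u \<in> unit_cell \<Longrightarrow> \<bar>\<phi> u\<bar> \<le> B"
    unfolding bounded_pos by auto
  define D where "D = B + \<bar>\<phi> t\<bar>"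
  have D: "D > 0" using B by (simp add: D_def add_pos_nonneg)
  have bound: "\<bar>(\<phi> u - \<phi> t) * fejer_kernel n (t - u)\<bar> \<le> \<epsilon> / 2 * fejer_kernel n (t - u) + D / (real n * s)"
    if u: "u \<in> unit_cell" and n: "n > 0" for u n
  proof -
    define k where "k = round (u - t)"
    define r where "r = u - t - of_int k"
    have r: "\<bar>r\<bar> \<le> 1/2" using of_int_round_abs_le[of "u - t"] by (simp add: r_def k_def abs_minus_commute)
    show ?thesis
    proof (cases "\<bar>r\<bar> < d")
      case True
      then have "\<bar>\<phi> (t + r) - \<phi> t\<bar> < \<epsilon> / 2" using d0(2)[of "t + r"] d by simp
      moreover have "\<phi> (t + r) = \<phi> u" using per'[of "t + r" k] by (simp add: r_def)
      ultimately have "\<bar>\<phi> u - \<phi> t\<bar> * fejer_kernel n (t - u) \<le> \<epsilon> / 2 * fejer_kernel n (t - u)"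
        using fejer_kernel_nonneg by (intro mult_right_mono) auto
      moreover have "D / (real n * s) \<ge> 0" using D s by simp
      ultimately show ?thesis using fejer_kernel_nonneg by (simp add: abs_mult)
    next
      case False
      have ss: "(sin (pi * (t - u)))\<^sup>2 = (sin (pi * \<bar>r\<bar>))\<^sup>2"
      proof -
        have e: "pi * (t - u) = - (pi * r) - pi * of_int k" by (simp add: r_def algebra_simps)
        have z: "sin (pi * of_int k) = 0" by (metis sin_npi_int)
        then have "(cos (pi * of_int k))\<^sup>2 = 1" by (simp add: cos_squared_eq)
        then have "(sin (pi * (t - u)))\<^sup>2 = (sin (pi * r))\<^sup>2"
          unfolding e sin_diff z by (simp add: power_mult_distrib)
        then show ?thesis by (cases "r \<ge> 0") auto
      qed
      have "sin (pi * d) \<le> sin (pi * \<bar>r\<bar>)"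
      proof (rule sin_monotone_2pi_le)
        have "0 \<le> pi * d" using d by simp
        then show "- (pi / 2) \<le> pi * d" using pi_gt_zero by linarith
      qed (use False r in auto)
      moreover have "sin (pi * d) \<ge> 0" using d by (intro sin_ge_zero) (auto simp: field_simps)
      ultimately have sl: "s \<le> (sin (pi * (t - u)))\<^sup>2"
        unfolding ss s_def by (intro power_mono)
      with s have "sin (pi * (t - u)) \<noteq> 0" by auto
      then have "fejer_kernel n (t - u) \<le> 1 / (real n * (sin (pi * (t - u)))\<^sup>2)"
        by (rule fejer_kernel_le[OF _ n])
      also have "\<dots> \<le> 1 / (real n * s)"
        using sl s n by (intro divide_left_mono mult_left_mono mult_pos_pos) auto
      finally have "\<bar>\<phi> u - \<phi> t\<bar> * fejer_kernel n (t - u) \<le> D * (1 / (real n * s))"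
        using B(2)[OF u] D fejer_kernel_nonneg by (intro mult_mono) (auto simp: D_def)
      moreover have "\<epsilon> / 2 * fejer_kernel n (t - u) \<ge> 0" using e fejer_kernel_nonneg by simp
      ultimately show ?thesis using fejer_kernel_nonneg by (simp add: abs_mult)
    qed
  qed
  obtain n0 where n0: "real n0 > 2 * D / (s * \<epsilon>)" using reals_Archimedean2 by blast
  show "\<exists>n0. \<forall>n\<ge>n0. norm (integral unit_cell (\<lambda>u. \<phi> u * fejer_kernel n (t - u)) - \<phi> t) < \<epsilon>"
  proof (intro exI[of _ "Suc n0"] allI impI)
    fix n assume "n \<ge> Suc n0"
    then have n: "n > 0" "real n > 2 * D / (s * \<epsilon>)" using n0 by linarith+
    have cphi: "continuous_on unit_cell \<phi>" by (rule continuous_on_subset[OF cont]) auto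
    have i1: "((\<lambda>u. \<phi> u * fejer_kernel n (t - u)) has_integral
        integral unit_cell (\<lambda>u. \<phi> u * fejer_kernel n (t - u))) unit_cell"
      by (intro integrable_integral integrable_continuous_interval continuous_on_mult cphi continuous_on_fejer_kernel)
    have i2: "((\<lambda>u. (\<phi> u - \<phi> t) * fejer_kernel n (t - u)) has_integral
        (integral unit_cell (\<lambda>u. \<phi> u * fejer_kernel n (t - u)) - \<phi> t)) unit_cell"
      using has_integral_diff[OF i1 has_integral_mult_right[OF has_integral_fejer_kernel[OF n(1)], where c = "\<phi> t"]]
      by (simp add: left_diff_distrib)
    have i3: "((\<lambda>u. \<epsilon> / 2 * fejer_kernel n (t - u) + D / (real n * s)) has_integral
        (\<epsilon> / 2 * 1 + D / (real n * s))) unit_cell"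
      using has_integral_add[OF has_integral_mult_right[OF has_integral_fejer_kernel[OF n(1)], where c = "\<epsilon> / 2"]
          has_integral_const_real[of "D / (real n * s)" "- (1/2)" "1/2"]] by simp
    have "norm (integral unit_cell (\<lambda>u. \<phi> u * fejer_kernel n (t - u)) - \<phi> t)
        \<le> \<epsilon> / 2 * 1 + D / (real n * s)"
      unfolding i2[THEN integral_unique, symmetric] i3[THEN integral_unique, symmetric]
      using bound[OF _ n(1)] i2 i3
      by (intro integral_norm_bound_integral) (auto simp: has_integral_integrable)
    also have "D / (real n * s) < \<epsilon> / 2"
      using n s e D by (simp add: field_simps)
    finally show "norm (integral unit_cell (\<lambda>u. \<phi> u * fejer_kernel n (t - u)) - \<phi> t) < \<epsilon>" by simp
  qed
qed

section \<open>Quadratic forms dominated by samples\<close>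

text \<open>Averaging over \<open>m\<close> and \<open>-m\<close> keeps everything real: the sine parts of the two expanded squares cancel.\<close>

lemma quadratic_form_characters:
  fixes a :: "'i \<Rightarrow> complex" and p :: "'i \<Rightarrow> real" and m :: real
  shows "(\<Sum>i\<in>I. \<Sum>j\<in>I. Re (a i * cnj (a j)) * cos (2 * pi * m * (p i - p j)))
    = ((cmod (\<Sum>i\<in>I. a i * cis (2 * pi * m * p i)))\<^sup>2
       + (cmod (\<Sum>i\<in>I. a i * cis (2 * pi * (- m) * p i)))\<^sup>2) / 2"
proof -
  have sq: "(cmod (\<Sum>i\<in>I. a i * cis (2 * pi * m * p i)))\<^sup>2
      = (\<Sum>i\<in>I. \<Sum>j\<in>I. Re (a i * cnj (a j) * cis (2 * pi * m * (p i - p j))))" for m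
  proof -
    have "(cmod (\<Sum>i\<in>I. a i * cis (2 * pi * m * p i)))\<^sup>2
        = Re ((\<Sum>i\<in>I. a i * cis (2 * pi * m * p i)) * cnj (\<Sum>i\<in>I. a i * cis (2 * pi * m * p i)))"
      by (simp add: complex_norm_square[symmetric] del: Re_sum cnj_sum)
    also have "\<dots> = (\<Sum>i\<in>I. \<Sum>j\<in>I. Re (a i * cnj (a j) * cis (2 * pi * m * (p i - p j))))"
      unfolding cnj_sum sum_product Re_sum
    proof (intro sum.cong refl)
      fix i j
      have "cis (2 * pi * m * (p i - p j)) = cis (2 * pi * m * p i) * cnj (cis (2 * pi * m * p j))"
        by (simp add: cis_cnj cis_mult algebra_simps)
      then show "Re (a i * cis (2 * pi * m * p i) * cnj (a j * cis (2 * pi * m * p j)))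
          = Re (a i * cnj (a j) * cis (2 * pi * m * (p i - p j)))"
        by (simp only: complex_cnj_mult mult.assoc mult.left_commute)
    qed
    finally show ?thesis .
  qed
  show ?thesis
    unfolding sq sum.distrib[symmetric] sum_divide_distrib
    by (intro sum.cong refl) simp
qed

lemma sum_quadratic_form_characters:
  fixes a :: "'i \<Rightarrow> complex" and p :: "'i \<Rightarrow> real"
  shows "(\<Sum>m\<in>{- int N..int N}. \<Sum>i\<in>I. \<Sum>j\<in>I. Re (a i * cnj (a j)) * cos (2 * pi * of_int m * (p i - p j)))
    = (\<Sum>m\<in>{- int N..int N}. (cmod (\<Sum>i\<in>I. a i * cis (2 * pi * of_int m * p i)))\<^sup>2)"
proof -
  define H where "H = (\<lambda>m::int. (cmod (\<Sum>i\<in>I. a i * cis (2 * pi * of_int m * p i)))\<^sup>2)"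
  have H: "H m = (cmod (\<Sum>i\<in>I. a i * cis (2 * pi * of_int m * p i)))\<^sup>2" for m
    by (simp add: H_def)
  have "(\<Sum>m\<in>{- int N..int N}. H (- m)) = (\<Sum>m\<in>{- int N..int N}. H m)"
    by (rule sum.reindex_bij_witness[of _ uminus uminus]) auto
  then show ?thesis
    unfolding quadratic_form_characters of_int_minus[symmetric]
    unfolding H[symmetric] sum_divide_distrib[symmetric] sum.distrib by simp
qed

text \<open>Formally, the left-hand side is \<open>\<Sum>m. w m * \<bar>h m\<bar>\<^sup>2\<close> with \<open>h m = \<Sum>i. a i * e(m * p i)\<close>, where \<open>e(x)\<close> is \<open>cis (2 * pi * x)\<close>, and dropping the
  nonpositive terms gives the bound. To need no convergence of Fourier series, replace \<open>\<phi>\<close> by its Fejer means: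
  these are finite sums. With \<open>P m\<close> the mean of \<open>\<bar>h m\<bar>\<^sup>2\<close> and \<open>\<bar>h (-m)\<bar>\<^sup>2\<close>, each row \<open>k\<close> of the double sum of
  \<open>w (k - l) * P (k - l)\<close> over \<open>k, l < n\<close> is at most the sum of \<open>P\<close> over \<open>[-N, N]\<close>, and the Fejer mean is the average
  of the rows.\<close>

lemma minorant_quadratic_form_le:
  fixes \<phi> :: "real \<Rightarrow> real" and w :: "int \<Rightarrow> real"
    and a :: "'i \<Rightarrow> complex" and p :: "'i \<Rightarrow> real"
  assumes cont: "continuous_on UNIV \<phi>" and per: "\<And>u. \<phi> (u + 1) = \<phi> u"
    and even: "\<And>u. \<phi> (- u) = \<phi> u"
    and w: "\<And>m. ((\<lambda>u. \<phi> u * cos (2 * pi * of_int m * u)) has_integral w m) unit_cell"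
    and w_le: "\<And>m. \<bar>m\<bar> \<le> int N \<Longrightarrow> w m \<le> 1" "\<And>m. \<bar>m\<bar> > int N \<Longrightarrow> w m \<le> 0"
    and fin: "finite I"
  shows "(\<Sum>i\<in>I. \<Sum>j\<in>I. Re (a i * cnj (a j)) * \<phi> (p i - p j))
    \<le> (\<Sum>m\<in>{- int N..int N}. (cmod (\<Sum>i\<in>I. a i * cis (2 * pi * of_int m * p i)))\<^sup>2)"
proof -
  define P where "P = (\<lambda>m::int. \<Sum>i\<in>I. \<Sum>j\<in>I. Re (a i * cnj (a j)) * cos (2 * pi * of_int m * (p i - p j)))"
  have P_eq: "P m = ((cmod (\<Sum>i\<in>I. a i * cis (2 * pi * of_int m * p i)))\<^sup>2
       + (cmod (\<Sum>i\<in>I. a i * cis (2 * pi * of_int (- m) * p i)))\<^sup>2) / 2" for m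
    unfolding P_def quadratic_form_characters by (simp only: of_int_minus)
  have P0: "P m \<ge> 0" for m unfolding P_eq by simp
  define T where "T = (\<lambda>n t. integral unit_cell (\<lambda>u. \<phi> u * fejer_kernel n (t - u)))"
  have coeff: "((\<lambda>u. \<phi> u * cos (2 * pi * of_int m * (t - u))) has_integral
      w m * cos (2 * pi * of_int m * t)) unit_cell" for m t
  proof -
    have "((\<lambda>u. \<phi> u * sin (2 * pi * of_int m * u)) has_integral 0) unit_cell"
    proof -
      define J where "J = integral unit_cell (\<lambda>u. \<phi> u * sin (2 * pi * of_int m * u))"
      have J: "((\<lambda>u. \<phi> u * sin (2 * pi * of_int m * u)) has_integral J) unit_cell"
        unfolding J_def
        by (intro integrable_integral integrable_continuous_interval continuous_intros
              continuous_on_subset[OF cont]) auto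
      have "((\<lambda>u. \<phi> (- u) * sin (2 * pi * of_int m * (- u))) has_integral J) unit_cell"
        using J has_integral_reflect_real[of "\<lambda>u. \<phi> u * sin (2 * pi * of_int m * u)" J "1/2" "- (1/2)"]
        by simp
      then have "((\<lambda>u. - (\<phi> u * sin (2 * pi * of_int m * u))) has_integral J) unit_cell"
        by (simp add: even)
      with has_integral_neg[OF J] have "J = - J" by (rule has_integral_unique[rotated])
      with J show ?thesis by simp
    qed
    from has_integral_add[OF has_integral_mult_right[OF w[of m], where c = "cos (2 * pi * of_int m * t)"]
        has_integral_mult_right[OF this, where c = "sin (2 * pi * of_int m * t)"]]
    show ?thesis by (simp add: right_diff_distrib cos_diff algebra_simps)
  qed
  have T_eq: "T n t = (\<Sum>k<n. \<Sum>l<n. w (int k - int l) * cos (2 * pi * of_int (int k - int l) * t)) / real n"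
    for n t
  proof -
    have "((\<lambda>u. (\<Sum>k<n. \<Sum>l<n. \<phi> u * cos (2 * pi * of_int (int k - int l) * (t - u))) / real n)
       has_integral (\<Sum>k<n. \<Sum>l<n. w (int k - int l) * cos (2 * pi * of_int (int k - int l) * t)) / real n)
       unit_cell"
      by (intro has_integral_divide has_integral_sum finite_lessThan coeff)
    then show ?thesis
      unfolding T_def fejer_kernel_def times_divide_eq_right sum_distrib_left by (rule integral_unique)
  qed
  have Q_le: "(\<Sum>i\<in>I. \<Sum>j\<in>I. Re (a i * cnj (a j)) * T n (p i - p j)) \<le> (\<Sum>m\<in>{- int N..int N}. P m)"
    if n: "n > 0" for n
  proof -
    have row: "(\<Sum>l<n. w (int k - int l) * P (int k - int l)) \<le> (\<Sum>m\<in>{- int N..int N}. P m)" for k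
    proof -
      let ?J = "{l \<in> {..<n}. \<bar>int k - int l\<bar> \<le> int N}"
      have "(\<Sum>l<n. w (int k - int l) * P (int k - int l))
          \<le> (\<Sum>l<n. if \<bar>int k - int l\<bar> \<le> int N then P (int k - int l) else 0)"
      proof (intro sum_mono)
        fix l
        show "w (int k - int l) * P (int k - int l)
            \<le> (if \<bar>int k - int l\<bar> \<le> int N then P (int k - int l) else 0)"
          using w_le[of "int k - int l"] P0[of "int k - int l"]
            mult_right_mono[of "w (int k - int l)" 1 "P (int k - int l)"]
            mult_nonpos_nonneg[of "w (int k - int l)" "P (int k - int l)"] by auto
      qed
      also have "\<dots> = (\<Sum>l\<in>?J. P (int k - int l))"
        by (rule sum.inter_filter[symmetric]) simp
      also have "\<dots> = sum P ((\<lambda>l. int k - int l) ` ?J)"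
        by (subst sum.reindex) (auto simp: inj_on_def)
      also have "\<dots> \<le> sum P {- int N..int N}"
        using P0 by (intro sum_mono2) auto
      finally show ?thesis .
    qed
    have "(\<Sum>i\<in>I. \<Sum>j\<in>I. Re (a i * cnj (a j)) * T n (p i - p j))
      = (\<Sum>k<n. \<Sum>l<n. \<Sum>i\<in>I. \<Sum>j\<in>I. w (int k - int l) *
           (Re (a i * cnj (a j)) * cos (2 * pi * of_int (int k - int l) * (p i - p j)))) / real n"
    proof -
      have sw: "(\<Sum>i\<in>I. \<Sum>j\<in>I. \<Sum>k<n. \<Sum>l<n. G i j k l) = (\<Sum>k<n. \<Sum>l<n. \<Sum>i\<in>I. \<Sum>j\<in>I. G i j k l)"
        for G :: "'i \<Rightarrow> 'i \<Rightarrow> nat \<Rightarrow> nat \<Rightarrow> real"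
      proof -
        have sw1: "(\<Sum>j\<in>I. \<Sum>k<n. \<Sum>l<n. g j k l) = (\<Sum>k<n. \<Sum>l<n. \<Sum>j\<in>I. g j k l)"
          for g :: "'i \<Rightarrow> nat \<Rightarrow> nat \<Rightarrow> real"
          by (rule trans[OF sum.swap]) (rule sum.cong[OF refl], rule sum.swap)
        show ?thesis unfolding sw1 ..
      qed
      have "(\<Sum>i\<in>I. \<Sum>j\<in>I. Re (a i * cnj (a j)) * T n (p i - p j))
        = (\<Sum>i\<in>I. \<Sum>j\<in>I. \<Sum>k<n. \<Sum>l<n. w (int k - int l) *
           (Re (a i * cnj (a j)) * cos (2 * pi * of_int (int k - int l) * (p i - p j)))) / real n"
        unfolding T_eq sum_divide_distrib sum_distrib_left
        by (intro sum.cong refl) simp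
      then show ?thesis unfolding sw .
    qed
    also have "\<dots> = (\<Sum>k<n. \<Sum>l<n. w (int k - int l) * P (int k - int l)) / real n"
      unfolding sum_distrib_left[symmetric] P_def ..
    also have "\<dots> \<le> (\<Sum>k<n. \<Sum>m\<in>{- int N..int N}. P m) / real n"
      by (intro divide_right_mono sum_mono row) auto
    also have "\<dots> = (\<Sum>m\<in>{- int N..int N}. P m)" using n by simp
    finally show ?thesis .
  qed
  have "(\<lambda>n. \<Sum>i\<in>I. \<Sum>j\<in>I. Re (a i * cnj (a j)) * T n (p i - p j))
      \<longlonglongrightarrow> (\<Sum>i\<in>I. \<Sum>j\<in>I. Re (a i * cnj (a j)) * \<phi> (p i - p j))"
    unfolding T_def by (intro tendsto_intros fejer_means_tendsto cont per)
  then have "(\<Sum>i\<in>I. \<Sum>j\<in>I. Re (a i * cnj (a j)) * \<phi> (p i - p j)) \<le> (\<Sum>m\<in>{- int N..int N}. P m)"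
    by (rule LIMSEQ_le_const2) (use Q_le in \<open>auto intro!: exI[of _ 1]\<close>)
  also have "\<dots> = (\<Sum>m\<in>{- int N..int N}. (cmod (\<Sum>i\<in>I. a i * cis (2 * pi * of_int m * p i)))\<^sup>2)"
    unfolding P_def sum_quadratic_form_characters ..
  finally show ?thesis .
qed

section \<open>The localising kernel\<close>

text \<open>The minimum extends the transform by its value 0 at 1, which makes the function continuous. For \<open>L \<ge> 2\<close> its
  support in a period has at most the length of that period, so nothing overlaps and its Fourier
  coefficients are those of the rescaled transform on the line.\<close>

definition selberg_kernel :: "real \<Rightarrow> real \<Rightarrow> real" where
  "selberg_kernel L t = L * selberg_transform (min 1 (L * wrap_dist t 0))"

lemma has_integral_selberg_kernel_cos:
  assumes L: "L \<ge> 2"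
  shows "((\<lambda>u. selberg_kernel L u * cos (2 * pi * of_int m * u)) has_integral selberg_minorant (\<bar>of_int m\<bar> / L)) unit_cell"
proof -
  define x where "x = \<bar>of_int m\<bar> / L"
  define g where "g = (\<lambda>s. selberg_transform s * cos (2 * pi * x * s))"
  define G where "G = (\<lambda>u. selberg_kernel L u * cos (2 * pi * of_int m * u))"
  have Lpos: "L > 0" "1 / L \<le> 1 / 2" using L by (auto simp: field_simps)
  have gcos: "cos (2 * pi * of_int m * u) = cos (2 * pi * x * (L * u))" for u
  proof -
    have "x * L = \<bar>of_int m\<bar>" using Lpos by (simp add: x_def)
    then have "2 * pi * x * (L * u) = 2 * pi * \<bar>of_int m\<bar> * u" by (metis mult.assoc)
    also have "cos \<dots> = cos (2 * pi * of_int m * u)" by (cases "m \<ge> 0") simp_all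
    finally show ?thesis ..
  qed
  have "(g has_integral (selberg_minorant x / 2)) {0..1}"
    unfolding selberg_minorant_def g_def
    by (simp, intro integrable_integral integrable_continuous_interval continuous_intros continuous_on_selberg_transform)
  then have "((\<lambda>u. g (L * u)) has_integral (1 / L * (selberg_minorant x / 2))) {0..1 / L}"
    using has_integral_stretch_real[of g "selberg_minorant x / 2" 0 1 L] Lpos by (simp add: image_divide_atLeastAtMost)
  then have "((\<lambda>u. L * g (L * u)) has_integral (selberg_minorant x / 2)) {0..1 / L}"
    using has_integral_mult_right[of _ "1 / L * (selberg_minorant x / 2)" _ L] Lpos by force
  moreover have "L * g (L * u) = G u" if "u \<in> {0..1 / L}" for u
  proof -
    have "0 \<le> u" "u \<le> 1 / L" using that by auto
    then have "\<bar>u\<bar> \<le> 1 / 2" "L * u \<le> 1" using Lpos by (linarith, simp add: field_simps)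
    then show ?thesis
      using that by (simp add: G_def selberg_kernel_def g_def gcos wrap_dist_zero_eq_abs min_absorb2)
  qed
  ultimately have 1: "(G has_integral (selberg_minorant x / 2)) {0..1 / L}"
    by (rule has_integral_eq[rotated])
  have "G u = 0" if "u \<in> {1 / L..1 / 2}" for u
  proof -
    have "0 < 1 / L" "1 / L \<le> u" "u \<le> 1 / 2" using that Lpos by auto
    then have "\<bar>u\<bar> \<le> 1 / 2" "L * u \<ge> 1" "u \<ge> 0" using Lpos by (linarith, simp add: field_simps, linarith)
    then show ?thesis
      by (simp add: G_def selberg_kernel_def wrap_dist_zero_eq_abs min_absorb1 selberg_transform_1)
  qed
  then have 2: "(G has_integral 0) {1 / L..1 / 2}"
    by (rule has_integral_is_0)
  have pos: "(G has_integral (selberg_minorant x / 2)) {0..1 / 2}"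
    using has_integral_combine[OF _ _ 1 2] Lpos by simp
  have even: "G (- u) = G u" for u
    by (simp add: G_def selberg_kernel_def wrap_dist_minus)
  have neg: "(G has_integral (selberg_minorant x / 2)) {- (1 / 2)..0}"
    using pos has_integral_reflect_real[of G "selberg_minorant x / 2" 0 "- (1 / 2)"] 
    by (simp add: even)
  show ?thesis
    using has_integral_combine[OF _ _ neg pos] unfolding G_def x_def by simp
qed

text \<open>For \<open>N \<ge> 2\<close> this is the Selberg kernel with \<open>L = 2 * (N + 1) / 3\<close>, so that \<open>m = N + 1\<close> corresponds to the end point
  \<open>x = 3 / 2\<close> of the rescaled interval and \<open>1 / L\<close> is the required localisation. For \<open>N = 1\<close> the radius \<open>3 / 4\<close> exceeds
  every wrap-around distance, so \<open>\<phi>\<close> need not vanish anywhere, and the Dirichlet kernel serves, with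
  equality in the quadratic form.\<close>

lemma localising_kernel_exists:
  assumes N: "N \<ge> (1::nat)"
  obtains \<phi> :: "real \<Rightarrow> real" where
    "\<And>(I :: 'i set) a p. finite I \<Longrightarrow>
       (\<Sum>i\<in>I. \<Sum>j\<in>I. Re (a i * cnj (a j)) * \<phi> (p i - p j))
       \<le> (\<Sum>m\<in>{- int N..int N}. (cmod (\<Sum>i\<in>I. a i * cis (2 * pi * of_int m * p i)))\<^sup>2)"
    and "\<And>t. \<phi> (- t) = \<phi> t"
    and "\<And>t. wrap_dist t 0 \<ge> 3 / (2 * real N + 2) \<Longrightarrow> \<phi> t = 0"
    and "\<phi> 0 \<ge> (4 * real N + 4) / 3"
    and "\<And>t. (\<phi> 0 + \<phi> t) / 2 \<ge> (real N + 1) / 3"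
    and "\<And>t. wrap_dist t 0 < 3 / (2 * real N + 2) \<Longrightarrow>
       (\<phi> 0 - \<phi> t) / 2 \<ge> 2 * pi\<^sup>2 * (real N + 1) ^ 3 / 3 ^ 5 * (wrap_dist t 0)\<^sup>2"
proof (cases "N = 1")
  case True
  define \<phi> where "\<phi> = (\<lambda>t::real. 1 + 2 * cos (2 * pi * t))"
  show ?thesis
  proof (rule that[of \<phi>])
    fix I :: "'i set" and a p assume fin: "finite I"
    have "(\<Sum>m\<in>{- int N..int N}. \<Sum>i\<in>I. \<Sum>j\<in>I. Re (a i * cnj (a j)) * cos (2 * pi * of_int m * (p i - p j)))
      = (\<Sum>i\<in>I. \<Sum>j\<in>I. Re (a i * cnj (a j)) * \<phi> (p i - p j))"
    proof -
      have set: "{- int N..int N} = {-1, 0, 1}" using True by auto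
      have "(\<Sum>m\<in>{- int N..int N}. C * cos (2 * pi * of_int m * d)) = C * \<phi> d" for C d
        unfolding set by (simp add: \<phi>_def algebra_simps)
      then have "(\<Sum>i\<in>I. \<Sum>j\<in>I. Re (a i * cnj (a j)) * \<phi> (p i - p j))
        = (\<Sum>i\<in>I. \<Sum>j\<in>I. \<Sum>m\<in>{- int N..int N}. Re (a i * cnj (a j)) * cos (2 * pi * of_int m * (p i - p j)))"
        by simp
      also have "\<dots> = (\<Sum>i\<in>I. \<Sum>m\<in>{- int N..int N}. \<Sum>j\<in>I. Re (a i * cnj (a j)) * cos (2 * pi * of_int m * (p i - p j)))"
        by (rule sum.cong[OF refl], rule sum.swap)
      also have "\<dots> = (\<Sum>m\<in>{- int N..int N}. \<Sum>i\<in>I. \<Sum>j\<in>I. Re (a i * cnj (a j)) * cos (2 * pi * of_int m * (p i - p j)))"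
        by (rule sum.swap)
      finally show ?thesis ..
    qed
    then show "(\<Sum>i\<in>I. \<Sum>j\<in>I. Re (a i * cnj (a j)) * \<phi> (p i - p j))
       \<le> (\<Sum>m\<in>{- int N..int N}. (cmod (\<Sum>i\<in>I. a i * cis (2 * pi * of_int m * p i)))\<^sup>2)"
      unfolding sum_quadratic_form_characters by simp
  next
    fix t
    show "\<phi> (- t) = \<phi> t" by (simp add: \<phi>_def)
    show "\<phi> t = 0" if "wrap_dist t 0 \<ge> 3 / (2 * real N + 2)"
      using that wrap_dist_le_half[of t 0] True by simp
    show "\<phi> 0 \<ge> (4 * real N + 4) / 3" using True by (simp add: \<phi>_def)
    show "(\<phi> 0 + \<phi> t) / 2 \<ge> (real N + 1) / 3"
      using True cos_ge_minus_one[of "2 * pi * t"] unfolding \<phi>_def by (simp add: field_simps del: cos_ge_minus_one)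
    obtain k where k: "wrap_dist t 0 = \<bar>t - of_int k\<bar>" using wrap_dist_attained[of t 0] by auto
    have "2 * pi * wrap_dist t 0 = \<bar>2 * pi * (t - of_int k)\<bar>" by (simp add: k abs_mult)
    then have "cos (2 * pi * wrap_dist t 0) = cos (2 * pi * (t - of_int k))"
      by (simp only: cos_abs_real)
    also have "\<dots> = cos (2 * pi * t)"
      using cos_diff[of "2 * pi * t" "2 * pi * of_int k"] by (simp add: right_diff_distrib)
    finally have "1 - cos (2 * pi * t) \<ge> (2 * pi * wrap_dist t 0)\<^sup>2 / 18"
      using one_minus_cos_ge[of "2 * pi * wrap_dist t 0"] wrap_dist_le_half[of t 0] wrap_dist_nonneg[of t 0]
      by (simp add: abs_mult)
    moreover have "2 * pi\<^sup>2 * 2 ^ 3 / 3 ^ 5 * (wrap_dist t 0)\<^sup>2 \<le> (2 * pi * wrap_dist t 0)\<^sup>2 / 18"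
      by (simp add: power_mult_distrib)
    ultimately show "(\<phi> 0 - \<phi> t) / 2 \<ge> 2 * pi\<^sup>2 * (real N + 1) ^ 3 / 3 ^ 5 * (wrap_dist t 0)\<^sup>2"
      using True by (simp add: \<phi>_def)
  qed
next
  case False
  define L where "L = 2 * (real N + 1) / 3"
  have L: "L \<ge> 2" using False N by (simp add: L_def)
  have NL: "real N + 1 = 3 / 2 * L" by (simp add: L_def)
  have q: "3 / (2 * real N + 2) = 1 / L" by (simp add: L_def field_simps)
  have k0: "selberg_kernel L 0 = 2 * L"
    by (simp add: selberg_kernel_def wrap_dist_zero_eq_abs selberg_transform_0)
  show ?thesis
  proof (rule that[of "selberg_kernel L"])
    fix I :: "'i set" and a p assume fin: "finite I"
    show "(\<Sum>i\<in>I. \<Sum>j\<in>I. Re (a i * cnj (a j)) * selberg_kernel L (p i - p j))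
       \<le> (\<Sum>m\<in>{- int N..int N}. (cmod (\<Sum>i\<in>I. a i * cis (2 * pi * of_int m * p i)))\<^sup>2)"
    proof (rule minorant_quadratic_form_le[where w = "\<lambda>m. selberg_minorant (\<bar>of_int m\<bar> / L)"])
      show "continuous_on UNIV (selberg_kernel L)"
        unfolding selberg_kernel_def
        by (intro continuous_intros continuous_on_compose2[OF continuous_on_selberg_transform] continuous_on_wrap_dist) auto
      show "selberg_kernel L (u + 1) = selberg_kernel L u" "selberg_kernel L (- u) = selberg_kernel L u" for u
        by (simp_all add: selberg_kernel_def wrap_dist_add_1 wrap_dist_minus)
      show "((\<lambda>u. selberg_kernel L u * cos (2 * pi * of_int m * u)) has_integral selberg_minorant (\<bar>of_int m\<bar> / L)) unit_cell" for m
        by (rule has_integral_selberg_kernel_cos[OF L])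
      show "selberg_minorant (\<bar>of_int m\<bar> / L) \<le> 1" if "\<bar>m\<bar> \<le> int N" for m
      proof (rule selberg_minorant_le_1)
        have "real_of_int \<bar>m\<bar> < 3 / 2 * L" using that unfolding NL[symmetric] by linarith
        then show "\<bar>of_int m\<bar> / L < 3 / 2" using L by (simp add: field_simps)
      qed (use L in simp)
      show "selberg_minorant (\<bar>of_int m\<bar> / L) \<le> 0" if "\<bar>m\<bar> > int N" for m
      proof (rule selberg_minorant_nonpos)
        have "real_of_int \<bar>m\<bar> \<ge> 3 / 2 * L" using that unfolding NL[symmetric] by linarith
        then show "3 / 2 \<le> \<bar>of_int m\<bar> / L" using L by (simp add: field_simps)
      qed
    qed (rule fin)
  next
    fix t
    define s where "s = min 1 (L * wrap_dist t 0)"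
    have s: "0 \<le> s" "s \<le> 1" using L wrap_dist_nonneg[of t 0] by (auto simp: s_def)
    have kt: "selberg_kernel L t = L * selberg_transform s" by (simp add: selberg_kernel_def s_def)
    show "selberg_kernel L (- t) = selberg_kernel L t" by (simp add: selberg_kernel_def wrap_dist_minus)
    show "selberg_kernel L t = 0" if far: "wrap_dist t 0 \<ge> 3 / (2 * real N + 2)"
    proof -
      have "1 / L \<le> wrap_dist t 0" using far unfolding q .
      then have "L * wrap_dist t 0 \<ge> 1" using L by (simp add: field_simps)
      then show ?thesis by (simp add: selberg_kernel_def min_absorb1 selberg_transform_1)
    qed
    show "selberg_kernel L 0 \<ge> (4 * real N + 4) / 3" unfolding k0 by (simp add: L_def)
    have "(selberg_kernel L 0 + selberg_kernel L t) / 2 = L / 2 * (2 + selberg_transform s)" unfolding k0 kt by (simp add: algebra_simps)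
    also have "\<dots> \<ge> L / 2 * 1" using selberg_transform_ge[OF s] L by (intro mult_left_mono) auto
    finally show "(selberg_kernel L 0 + selberg_kernel L t) / 2 \<ge> (real N + 1) / 3" by (simp add: NL)
    show "(selberg_kernel L 0 - selberg_kernel L t) / 2 \<ge> 2 * pi\<^sup>2 * (real N + 1) ^ 3 / 3 ^ 5 * (wrap_dist t 0)\<^sup>2"
      if near: "wrap_dist t 0 < 3 / (2 * real N + 2)"
    proof -
      define v where "v = L * wrap_dist t 0"
      have "2 * pi\<^sup>2 * (real N + 1) ^ 3 / 3 ^ 5 * (wrap_dist t 0)\<^sup>2 = L / 2 * (pi\<^sup>2 * v\<^sup>2 / 18)"
        unfolding NL v_def by (simp add: power_mult_distrib power2_eq_square power3_eq_cube)
      also have "\<dots> \<le> L / 2 * (2 - selberg_transform s)"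
      proof (intro mult_left_mono)
        have "wrap_dist t 0 < 1 / L" using near unfolding q .
        then have "v \<le> 1" using L by (simp add: v_def field_simps)
        then have "s = v" by (simp add: s_def v_def)
        with two_minus_selberg_transform_ge[OF s] show "pi\<^sup>2 * v\<^sup>2 / 18 \<le> 2 - selberg_transform s" by simp
      qed (use L in simp)
      finally show ?thesis unfolding k0 kt by (simp add: algebra_simps)
    qed
  qed
qed

section \<open>Stability of the frequencies without noise\<close>

lemma separated_exp_sumsD:
  assumes "f \<in> separated_exp_sums s" "y \<in> exp_freqs f" "z \<in> exp_freqs f" "y \<noteq> z"
  shows "wrap_dist y z \<ge> s"
proof -
  have "ereal s \<le> sep (exp_freqs f)" using assms(1) by (simp add: separated_exp_sums_def)
  also have "\<dots> \<le> ereal (wrap_dist y z)"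
    unfolding sep_def using assms(2-) by (intro INF_lower2[of "(y, z)"]) auto
  finally show ?thesis by simp
qed

lemma two_point_form:
  fixes c d :: complex and u v :: real
  shows "u * ((cmod c)\<^sup>2 + (cmod d)\<^sup>2) - 2 * (Re (c * cnj d) * v)
    = (u + v) / 2 * (cmod (c - d))\<^sup>2 + (u - v) / 2 * (cmod (c + d))\<^sup>2"
  unfolding cmod_power2 by (simp add: power2_eq_square algebra_simps add_divide_distrib diff_divide_distrib)

text \<open>The kernel is evaluated on the disjoint union of the two frequency sets, since a frequency may belong to
  both. Separation by twice the localisation radius \<open>r\<close> kills the off-diagonal terms within each set, and by the
  triangle inequality a frequency of either set has at most one partner within \<open>r\<close> in the other.\<close>

lemma frequency_stability:
  fixes N :: nat and q c_min :: real and f g :: "real \<Rightarrow> complex"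
  defines "D \<equiv> \<Sum>m\<in>{- int N..int N}. (cmod (f (of_int m) - g (of_int m)))\<^sup>2"
    and "n \<equiv> \<lambda>y. THE z. z \<in> exp_freqs g \<and> wrap_dist y z < 3 / (2 * real N + 2)"
  assumes N: "N \<ge> 1" and q: "q \<ge> 3 / (2 * real N + 2)"
    and f: "f \<in> separated_exp_sums (2 * q)" and g: "g \<in> separated_exp_sums (2 * q)"
    and c_min: "c_min > 0" "\<And>y. y \<in> exp_freqs f \<Longrightarrow> cmod (exp_coeff f y) \<ge> c_min"
    and D_less: "D < (4 * real N + 4) / 3 * c_min\<^sup>2"
  shows "\<forall>y\<in>exp_freqs f. \<exists>!z. z \<in> exp_freqs g \<and> wrap_dist y z < 3 / (2 * real N + 2)"
    and "(\<Sum>y\<in>exp_freqs f.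
            (real N + 1) / 3 * (cmod (exp_coeff f y - exp_coeff g (n y)))\<^sup>2
          + 2 * pi\<^sup>2 * (real N + 1) ^ 3 / 3 ^ 5 * (wrap_dist y (n y))\<^sup>2
              * (cmod (exp_coeff f y + exp_coeff g (n y)))\<^sup>2) \<le> D"
proof -
  define r where "r = 3 / (2 * real N + 2)"
  define Y Z c d where YZ: "Y = exp_freqs f" "Z = exp_freqs g" "c = exp_coeff f" "d = exp_coeff g"
  have repf: "exp_sum_rep f Y c" and repg: "exp_sum_rep g Z d"
    unfolding YZ using f g by (auto simp: separated_exp_sums_def intro: exp_sum_rep_canonical)
  then have fin: "finite Y" "finite Z" by (auto simp: exp_sum_rep_def)
  have sepY: "wrap_dist y y' \<ge> 2 * r" if "y \<in> Y" "y' \<in> Y" "y \<noteq> y'" for y y'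
    using separated_exp_sumsD[OF f, of y y'] that q by (auto simp: YZ r_def)
  have sepZ: "wrap_dist y y' \<ge> 2 * r" if "y \<in> Z" "y' \<in> Z" "y \<noteq> y'" for y y'
    using separated_exp_sumsD[OF g, of y y'] that q by (auto simp: YZ r_def)
  have r: "r > 0" by (simp add: r_def)
  have uniqZ: "z = z'" if "z \<in> Z" "z' \<in> Z" "wrap_dist y z < r" "wrap_dist y z' < r" for y z z'
    using sepZ[of z z'] wrap_dist_triangle[of z z' y] wrap_dist_commute[of z y] that by force
  have uniqY: "y = y'" if "y \<in> Y" "y' \<in> Y" "wrap_dist y z < r" "wrap_dist y' z < r" for y y' z
    using sepY[of y y'] wrap_dist_triangle[of y y' z] wrap_dist_commute[of z y'] that by force
  define A where "A = {y \<in> Y. \<exists>z\<in>Z. wrap_dist y z < r}"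
  have nA: "n y \<in> Z" "wrap_dist y (n y) < r" if "y \<in> A" for y
  proof -
    have "\<exists>!z. z \<in> Z \<and> wrap_dist y z < r" using that uniqZ[of _ _ y] by (auto simp: A_def)
    from theI'[OF this] show "n y \<in> Z" "wrap_dist y (n y) < r" by (auto simp: n_def YZ r_def)
  qed
  have inj: "inj_on n A"
    by (rule inj_onI) (metis (no_types, lifting) A_def mem_Collect_eq nA(2) uniqY)
  obtain \<phi> where dom: "\<And>(I :: (real + real) set) a p. finite I \<Longrightarrow>
       (\<Sum>i\<in>I. \<Sum>j\<in>I. Re (a i * cnj (a j)) * \<phi> (p i - p j))
       \<le> (\<Sum>m\<in>{- int N..int N}. (cmod (\<Sum>i\<in>I. a i * cis (2 * pi * of_int m * p i)))\<^sup>2)"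
    and even: "\<And>t. \<phi> (- t) = \<phi> t"
    and far: "\<And>t. wrap_dist t 0 \<ge> r \<Longrightarrow> \<phi> t = 0"
    and phi0: "\<phi> 0 \<ge> (4 * real N + 4) / 3"
    and phi_plus: "\<And>t. (\<phi> 0 + \<phi> t) / 2 \<ge> (real N + 1) / 3"
    and phi_minus: "\<And>t. wrap_dist t 0 < r \<Longrightarrow>
       (\<phi> 0 - \<phi> t) / 2 \<ge> 2 * pi\<^sup>2 * (real N + 1) ^ 3 / 3 ^ 5 * (wrap_dist t 0)\<^sup>2"
    by (rule localising_kernel_exists[OF N, where ?'i = "real + real", folded r_def]) (rule that)
  have phi0_pos: "\<phi> 0 > 0" by (rule less_le_trans[OF _ phi0]) simp
  define I where "I = Y <+> Z"
  define a where "a = case_sum c (\<lambda>z. - d z)"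
  define p where "p = case_sum (\<lambda>y. y) (\<lambda>z. z :: real)"
  have samples: "(\<Sum>i\<in>I. a i * cis (2 * pi * of_int m * p i)) = f (of_int m) - g (of_int m)" for m
  proof -
    have "cis (2 * pi * of_int m * y) = exp (2 * pi * \<i> * y * complex_of_real (of_int m))" for y
      by (simp add: cis_conv_exp mult_ac)
    moreover have "f (of_int m) = (\<Sum>y\<in>Y. c y * exp (2 * pi * \<i> * y * complex_of_real (of_int m)))"
      using repf unfolding exp_sum_rep_def by blast
    moreover have "g (of_int m) = (\<Sum>y\<in>Z. d y * exp (2 * pi * \<i> * y * complex_of_real (of_int m)))"
      using repg unfolding exp_sum_rep_def by blast
    ultimately show ?thesis
      using fin by (simp add: I_def sum.Plus a_def p_def o_def sum_negf)
  qed
  have diag: "(\<Sum>y\<in>W. \<Sum>y'\<in>W. Re (e y * cnj (e y')) * \<phi> (y - y')) = (\<Sum>y\<in>W. \<phi> 0 * (cmod (e y))\<^sup>2)"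
    if "finite W" and sepW: "\<And>y y'. y \<in> W \<Longrightarrow> y' \<in> W \<Longrightarrow> y \<noteq> y' \<Longrightarrow> wrap_dist y y' \<ge> 2 * r" for W e
  proof (rule sum.cong[OF refl])
    fix y assume y: "y \<in> W"
    have "(\<Sum>y'\<in>W. Re (e y * cnj (e y')) * \<phi> (y - y')) = (\<Sum>y'\<in>{y}. Re (e y * cnj (e y')) * \<phi> (y - y'))"
    proof (rule sum.mono_neutral_right)
      show "\<forall>y'\<in>W - {y}. Re (e y * cnj (e y')) * \<phi> (y - y') = 0"
      proof
        fix y' assume "y' \<in> W - {y}"
        then have "wrap_dist (y - y') 0 \<ge> r"
          using sepW[of y y'] y r wrap_dist_diff[of y y'] by auto
        then show "Re (e y * cnj (e y')) * \<phi> (y - y') = 0" by (simp add: far)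
      qed
    qed (use that y in auto)
    moreover have "Re (e y * cnj (e y)) = (cmod (e y))\<^sup>2"
      unfolding cmod_power2 by (simp add: power2_eq_square)
    ultimately show "(\<Sum>y'\<in>W. Re (e y * cnj (e y')) * \<phi> (y - y')) = \<phi> 0 * (cmod (e y))\<^sup>2"
      by simp
  qed
  define X where "X = (\<Sum>y\<in>Y. \<Sum>z\<in>Z. Re (c y * cnj (d z)) * \<phi> (y - z))"
  \<comment> \<open>The cross terms survive only on matched pairs, \<open>A\<close> being the matched frequencies of \<open>f\<close>.\<close>
  have X_eq: "X = (\<Sum>y\<in>A. Re (c y * cnj (d (n y))) * \<phi> (y - n y))"
  proof -
    have "X = (\<Sum>y\<in>A. \<Sum>z\<in>Z. Re (c y * cnj (d z)) * \<phi> (y - z))"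
      unfolding X_def
    proof (rule sum.mono_neutral_right)
      show "\<forall>y\<in>Y - A. (\<Sum>z\<in>Z. Re (c y * cnj (d z)) * \<phi> (y - z)) = 0"
        using far wrap_dist_diff by (auto intro!: sum.neutral simp: A_def not_less)
    qed (use fin in \<open>auto simp: A_def\<close>)
    also have "\<dots> = (\<Sum>y\<in>A. \<Sum>z\<in>{n y}. Re (c y * cnj (d z)) * \<phi> (y - z))"
    proof (rule sum.cong[OF refl], rule sum.mono_neutral_right)
      fix y assume y: "y \<in> A"
      show "\<forall>z\<in>Z - {n y}. Re (c y * cnj (d z)) * \<phi> (y - z) = 0"
      proof
        fix z assume "z \<in> Z - {n y}"
        then have "wrap_dist y z \<ge> r" using uniqZ[of z "n y" y] nA[OF y] by force
        then show "Re (c y * cnj (d z)) * \<phi> (y - z) = 0" using far wrap_dist_diff[of y z] by simp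
      qed
    qed (use fin nA in auto)
    finally show ?thesis by simp
  qed
  define B where "B = (\<lambda>y. \<phi> 0 * ((cmod (c y))\<^sup>2 + (cmod (d (n y)))\<^sup>2)
     - 2 * (Re (c y * cnj (d (n y))) * \<phi> (y - n y)))"
  define T where "T = (\<lambda>y. (real N + 1) / 3 * (cmod (c y - d (n y)))\<^sup>2
          + 2 * pi\<^sup>2 * (real N + 1) ^ 3 / 3 ^ 5 * (wrap_dist y (n y))\<^sup>2 * (cmod (c y + d (n y)))\<^sup>2)"
  have T0: "T y \<ge> 0" for y by (simp add: T_def)
  have T_le: "T y \<le> B y" if "y \<in> A" for y
  proof -
    have "wrap_dist (y - n y) 0 < r" using nA(2)[OF that] wrap_dist_diff[of y "n y"] by simp
    from phi_minus[OF this] show ?thesis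
      unfolding B_def two_point_form T_def
      using phi_plus wrap_dist_diff[of y "n y"] by (intro add_mono mult_right_mono) simp_all
  qed
  \<comment> \<open>Injectivity of the matching pays each \<open>d (n y)\<close> from the diagonal of \<open>g\<close>; unmatched frequencies of
    \<open>g\<close> only add nonnegative terms.\<close>
  have lower: "(\<Sum>y\<in>Y - A. \<phi> 0 * (cmod (c y))\<^sup>2) + (\<Sum>y\<in>A. B y) \<le> D"
  proof -
    have "(\<Sum>i\<in>I. \<Sum>j\<in>I. Re (a i * cnj (a j)) * \<phi> (p i - p j))
      = (\<Sum>y\<in>Y. \<phi> 0 * (cmod (c y))\<^sup>2) + (\<Sum>z\<in>Z. \<phi> 0 * (cmod (d z))\<^sup>2) - 2 * X"
    proof -
      have sym: "(\<Sum>z\<in>Z. \<Sum>y\<in>Y. Re (d z * cnj (c y)) * \<phi> (z - y)) = X"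
      proof -
        have "Re (d z * cnj (c y)) * \<phi> (z - y) = Re (c y * cnj (d z)) * \<phi> (y - z)" for y z
          using even[of "y - z"] by (simp add: mult.commute)
        then show ?thesis unfolding X_def by (subst sum.swap) simp
      qed
      have "(\<Sum>i\<in>I. \<Sum>j\<in>I. Re (a i * cnj (a j)) * \<phi> (p i - p j))
        = (\<Sum>y\<in>Y. \<Sum>y'\<in>Y. Re (c y * cnj (c y')) * \<phi> (y - y')) - X
          - (\<Sum>z\<in>Z. \<Sum>y\<in>Y. Re (d z * cnj (c y)) * \<phi> (z - y))
          + (\<Sum>z\<in>Z. \<Sum>z'\<in>Z. Re (d z * cnj (d z')) * \<phi> (z - z'))"
        using fin unfolding X_def
        by (simp add: I_def sum.Plus a_def p_def o_def sum.distrib sum_negf sum_subtractf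
            del: times_complex.simps)
      then show ?thesis
        using sym diag[OF fin(1) sepY, of c] diag[OF fin(2) sepZ, of d] by linarith
    qed
    moreover have "(\<Sum>i\<in>I. \<Sum>j\<in>I. Re (a i * cnj (a j)) * \<phi> (p i - p j)) \<le> D"
      using dom[of I a p] fin unfolding samples D_def by (simp add: I_def)
    moreover have "(\<Sum>z\<in>Z. \<phi> 0 * (cmod (d z))\<^sup>2) \<ge> (\<Sum>y\<in>A. \<phi> 0 * (cmod (d (n y)))\<^sup>2)"
    proof -
      have "(\<Sum>y\<in>A. \<phi> 0 * (cmod (d (n y)))\<^sup>2) = (\<Sum>z\<in>n ` A. \<phi> 0 * (cmod (d z))\<^sup>2)"
        using inj by (simp add: sum.reindex)
      also have "\<dots> \<le> (\<Sum>z\<in>Z. \<phi> 0 * (cmod (d z))\<^sup>2)"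
        using fin nA phi0_pos by (intro sum_mono2) auto
      finally show ?thesis .
    qed
    moreover have "(\<Sum>y\<in>Y. \<phi> 0 * (cmod (c y))\<^sup>2)
        = (\<Sum>y\<in>Y - A. \<phi> 0 * (cmod (c y))\<^sup>2) + (\<Sum>y\<in>A. \<phi> 0 * (cmod (c y))\<^sup>2)"
      using fin by (intro sum.subset_diff) (auto simp: A_def)
    moreover have "(\<Sum>y\<in>A. B y) = (\<Sum>y\<in>A. \<phi> 0 * (cmod (c y))\<^sup>2)
        + (\<Sum>y\<in>A. \<phi> 0 * (cmod (d (n y)))\<^sup>2) - 2 * X"
      unfolding X_eq B_def by (simp only: sum_subtractf sum.distrib distrib_left sum_distrib_left)
    ultimately show ?thesis by linarith
  qed
  have all: "A = Y"
  proof (rule ccontr)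
    assume "A \<noteq> Y"
    then obtain y where y: "y \<in> Y" "y \<notin> A" by (auto simp: A_def)
    have "(4 * real N + 4) / 3 * c_min\<^sup>2 \<le> \<phi> 0 * (cmod (c y))\<^sup>2"
      using phi0 c_min y by (intro mult_mono power_mono) (auto simp: YZ)
    also have "\<dots> \<le> (\<Sum>y\<in>Y - A. \<phi> 0 * (cmod (c y))\<^sup>2)"
      using y fin phi0_pos by (intro member_le_sum) auto
    also have "\<dots> \<le> D"
      using lower sum_nonneg[of A B] order_trans[OF T0 T_le] by fastforce
    finally show False using D_less by simp
  qed
  show "\<forall>y\<in>exp_freqs f. \<exists>!z. z \<in> exp_freqs g \<and> wrap_dist y z < 3 / (2 * real N + 2)"
  proof
    fix y assume "y \<in> exp_freqs f"
    then have "y \<in> A" by (simp add: all YZ)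
    then show "\<exists>!z. z \<in> exp_freqs g \<and> wrap_dist y z < 3 / (2 * real N + 2)"
      using uniqZ[of _ _ y] by (auto simp: A_def YZ r_def)
  qed
  have "sum T Y \<le> D"
    using sum_mono[of A T B] T_le lower by (simp add: all)
  then show "(\<Sum>y\<in>exp_freqs f.
            (real N + 1) / 3 * (cmod (exp_coeff f y - exp_coeff g (n y)))\<^sup>2
          + 2 * pi\<^sup>2 * (real N + 1) ^ 3 / 3 ^ 5 * (wrap_dist y (n y))\<^sup>2
              * (cmod (exp_coeff f y + exp_coeff g (n y)))\<^sup>2) \<le> D"
    unfolding T_def YZ .
qed

section \<open>Lower tails of Gaussian sums\<close>

context prob_space begin

text \<open>Markov's inequality for \<open>exp (- s * S)\<close>, where \<open>S\<close> is the sum; independence turns the Laplace transform of \<open>S\<close> into a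
  product.\<close>

lemma chernoff_lower_tail_sum:
  fixes h :: "'i \<Rightarrow> real \<Rightarrow> real" and Z :: "'i \<Rightarrow> 'a \<Rightarrow> real"
  assumes fin: "finite I" and indep: "indep_vars (\<lambda>_. borel) Z I"
    and h: "\<And>i. i \<in> I \<Longrightarrow> h i \<in> borel_measurable borel" and s: "s > 0"
    and laplace: "\<And>i. i \<in> I \<Longrightarrow> (\<integral>\<^sup>+\<omega>. ennreal (exp (- s * h i (Z i \<omega>))) \<partial>M) \<le> ennreal (exp (b i))"
  shows "prob {\<omega> \<in> space M. (\<Sum>i\<in>I. h i (Z i \<omega>)) \<le> a} \<le> exp (s * a + (\<Sum>i\<in>I. b i))"
proof -
  have Z: "Z i \<in> borel_measurable M" if "i \<in> I" for i
    using indep that by (auto simp: indep_vars_def)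
  have hZ: "(\<lambda>\<omega>. h i (Z i \<omega>)) \<in> borel_measurable M" if "i \<in> I" for i
    using measurable_compose[OF Z h] that by auto
  then have meas: "(\<lambda>\<omega>. \<Sum>i\<in>I. h i (Z i \<omega>)) \<in> borel_measurable M"
    by (rule borel_measurable_sum)
  have "ennreal (prob {\<omega> \<in> space M. (\<Sum>i\<in>I. h i (Z i \<omega>)) \<le> a})
      = emeasure M {\<omega> \<in> space M. (\<Sum>i\<in>I. h i (Z i \<omega>)) \<le> a}"
    by (simp add: emeasure_eq_measure)
  also have "\<dots> \<le> ennreal (exp (s * a)) *
      (\<integral>\<^sup>+\<omega>\<in>space M. ennreal (exp (- s * (\<Sum>i\<in>I. h i (Z i \<omega>)))) \<partial>M)"
    by (intro Chernoff_ineq_nn_integral_le s meas) auto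
  also have "(\<integral>\<^sup>+\<omega>\<in>space M. ennreal (exp (- s * (\<Sum>i\<in>I. h i (Z i \<omega>)))) \<partial>M)
      = (\<integral>\<^sup>+\<omega>. (\<Prod>i\<in>I. ennreal (exp (- s * h i (Z i \<omega>)))) \<partial>M)"
    by (intro nn_integral_cong)
       (simp add: sum_distrib_left exp_sum fin prod_ennreal flip: sum_negf)
  also have "\<dots> = (\<Prod>i\<in>I. \<integral>\<^sup>+\<omega>. ennreal (exp (- s * h i (Z i \<omega>))) \<partial>M)"
  proof (rule indep_vars_nn_integral[OF fin])
    show "indep_vars (\<lambda>_. borel) (\<lambda>i \<omega>. ennreal (exp (- s * h i (Z i \<omega>)))) I"
    proof (rule indep_vars_compose2[OF indep])
      fix i assume "i \<in> I"
      from h[OF this] show "(\<lambda>x. ennreal (exp (- s * h i x))) \<in> borel \<rightarrow>\<^sub>M borel" by measurable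
    qed
  qed simp
  also have "\<dots> \<le> (\<Prod>i\<in>I. ennreal (exp (b i)))"
    by (intro prod_mono_ennreal laplace)
  also have "\<dots> = ennreal (exp (\<Sum>i\<in>I. b i))"
    by (simp add: prod_ennreal exp_sum fin)
  finally have "ennreal (prob {\<omega> \<in> space M. (\<Sum>i\<in>I. h i (Z i \<omega>)) \<le> a})
      \<le> ennreal (exp (s * a)) * ennreal (exp (\<Sum>i\<in>I. b i))"
    by (simp add: mult_left_mono)
  then show ?thesis by (simp add: exp_add flip: ennreal_mult)
qed

lemma nn_integral_normal_density:
  "\<sigma> > 0 \<Longrightarrow> (\<integral>\<^sup>+x. ennreal (normal_density \<mu> \<sigma> x) \<partial>lborel) = 1"
  using nn_integral_eq_integral[of lborel "normal_density \<mu> \<sigma>"] by simp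

text \<open>Completing the square moves the mean of the density to \<open>s * \<sigma>\<^sup>2\<close>.\<close>

lemma normal_laplace_linear:
  assumes \<sigma>: "\<sigma> > 0" and Z: "distributed M lborel Z (normal_density 0 \<sigma>)"
  shows "(\<integral>\<^sup>+\<omega>. ennreal (exp (s * Z \<omega>)) \<partial>M) = ennreal (exp (s\<^sup>2 * \<sigma>\<^sup>2 / 2))"
proof -
  have "(\<integral>\<^sup>+\<omega>. ennreal (exp (s * Z \<omega>)) \<partial>M)
      = (\<integral>\<^sup>+x. ennreal (normal_density 0 \<sigma> x) * ennreal (exp (s * x)) \<partial>lborel)"
    using distributed_nn_integral[OF Z, of "\<lambda>x. ennreal (exp (s * x))"] by simp
  also have "\<dots> = (\<integral>\<^sup>+x. ennreal (exp (s\<^sup>2 * \<sigma>\<^sup>2 / 2)) * ennreal (normal_density (s * \<sigma>\<^sup>2) \<sigma> x) \<partial>lborel)"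
  proof (rule nn_integral_cong)
    fix x :: real
    have "- (x - 0)\<^sup>2 / (2 * \<sigma>\<^sup>2) + s * x = s\<^sup>2 * \<sigma>\<^sup>2 / 2 + - (x - s * \<sigma>\<^sup>2)\<^sup>2 / (2 * \<sigma>\<^sup>2)"
      using \<sigma> by (simp add: field_simps power2_eq_square)
    then have "normal_density 0 \<sigma> x * exp (s * x) = exp (s\<^sup>2 * \<sigma>\<^sup>2 / 2) * normal_density (s * \<sigma>\<^sup>2) \<sigma> x"
      unfolding normal_density_def by (simp add: exp_add[symmetric])
    then show "ennreal (normal_density 0 \<sigma> x) * ennreal (exp (s * x))
        = ennreal (exp (s\<^sup>2 * \<sigma>\<^sup>2 / 2)) * ennreal (normal_density (s * \<sigma>\<^sup>2) \<sigma> x)"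
      by (simp flip: ennreal_mult add: normal_density_nonneg)
  qed
  also have "\<dots> = ennreal (exp (s\<^sup>2 * \<sigma>\<^sup>2 / 2))"
    using \<sigma> by (simp add: nn_integral_cmult nn_integral_normal_density)
  finally show ?thesis .
qed

text \<open>The Gaussian factor changes the variance of the density from \<open>\<sigma>\<^sup>2\<close> to \<open>\<sigma>\<^sup>2 / (1 + 2 * s * \<sigma>\<^sup>2)\<close>.\<close>

lemma normal_laplace_square:
  assumes \<sigma>: "\<sigma> > 0" and Z: "distributed M lborel Z (normal_density 0 \<sigma>)" and s: "s \<ge> 0"
  shows "(\<integral>\<^sup>+\<omega>. ennreal (exp (- s * (Z \<omega>)\<^sup>2)) \<partial>M) = ennreal (1 / sqrt (1 + 2 * s * \<sigma>\<^sup>2))"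
proof -
  define K where "K = 1 + 2 * s * \<sigma>\<^sup>2"
  define \<rho> where "\<rho> = \<sigma> / sqrt K"
  have K: "K > 0" using s by (simp add: K_def add_pos_nonneg)
  have \<rho>: "\<rho> > 0" "\<rho>\<^sup>2 = \<sigma>\<^sup>2 / K" using K \<sigma> by (auto simp: \<rho>_def power_divide)
  have "(\<integral>\<^sup>+\<omega>. ennreal (exp (- s * (Z \<omega>)\<^sup>2)) \<partial>M)
      = (\<integral>\<^sup>+x. ennreal (normal_density 0 \<sigma> x) * ennreal (exp (- s * x\<^sup>2)) \<partial>lborel)"
    using distributed_nn_integral[OF Z, of "\<lambda>x. ennreal (exp (- s * x\<^sup>2))"] by simp
  also have "\<dots> = (\<integral>\<^sup>+x. ennreal (1 / sqrt K) * ennreal (normal_density 0 \<rho> x) \<partial>lborel)"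
  proof (rule nn_integral_cong)
    fix x :: real
    have e: "- (x - 0)\<^sup>2 / (2 * \<sigma>\<^sup>2) + - s * x\<^sup>2 = - (x - 0)\<^sup>2 / (2 * \<rho>\<^sup>2)"
    proof -
      have "- (x - 0)\<^sup>2 / (2 * \<rho>\<^sup>2) = - (x\<^sup>2 * K) / (2 * \<sigma>\<^sup>2)" using \<rho> K \<sigma> by simp
      also have "\<dots> = - (x - 0)\<^sup>2 / (2 * \<sigma>\<^sup>2) + - s * x\<^sup>2"
        using \<sigma> by (simp add: K_def field_simps)
      finally show ?thesis by simp
    qed
    have c: "1 / sqrt (2 * pi * \<sigma>\<^sup>2) = 1 / sqrt K * (1 / sqrt (2 * pi * \<rho>\<^sup>2))"
      using \<rho> K \<sigma> by (simp add: real_sqrt_divide real_sqrt_mult)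
    have "normal_density 0 \<sigma> x * exp (- s * x\<^sup>2) = 1 / sqrt K * normal_density 0 \<rho> x"
      unfolding normal_density_def c using e by (simp add: exp_add[symmetric] mult.assoc)
    then show "ennreal (normal_density 0 \<sigma> x) * ennreal (exp (- s * x\<^sup>2))
        = ennreal (1 / sqrt K) * ennreal (normal_density 0 \<rho> x)"
      using K by (simp flip: ennreal_mult add: normal_density_nonneg)
  qed
  also have "\<dots> = ennreal (1 / sqrt K)"
    using \<rho> by (simp add: nn_integral_cmult nn_integral_normal_density)
  finally show ?thesis by (simp add: K_def)
qed

text \<open>The strict inequality keeps the statement true for \<open>w = 0\<close>, where the event is empty.\<close>

lemma normal_linear_lower_tail:
  fixes Z :: "'i \<Rightarrow> 'a \<Rightarrow> real"
  assumes fin: "finite I" and indep: "indep_vars (\<lambda>_. borel) Z I" and \<sigma>: "\<sigma> > 0"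
    and Z: "\<And>i. i \<in> I \<Longrightarrow> distributed M lborel (Z i) (normal_density 0 \<sigma>)" and t: "t > 0"
  shows "prob {\<omega> \<in> space M. (\<Sum>i\<in>I. w i * Z i \<omega>) < - (\<sigma> * sqrt (\<Sum>i\<in>I. (w i)\<^sup>2) * t)} \<le> exp (- t\<^sup>2 / 2)"
proof (cases "(\<Sum>i\<in>I. (w i)\<^sup>2) = 0")
  case True
  then have "w i = 0" if "i \<in> I" for i using that fin by (simp add: sum_nonneg_eq_0_iff)
  then have "{\<omega> \<in> space M. (\<Sum>i\<in>I. w i * Z i \<omega>) < - (\<sigma> * sqrt (\<Sum>i\<in>I. (w i)\<^sup>2) * t)} = {}"
    using True by simp
  then show ?thesis by (simp only: measure_empty exp_ge_zero)
next
  case False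
  define x where "x = sqrt (\<Sum>i\<in>I. (w i)\<^sup>2)"
  have x: "x > 0" "x\<^sup>2 = (\<Sum>i\<in>I. (w i)\<^sup>2)"
    using False by (auto simp: x_def sum_nonneg less_le)
  define s where "s = t / (\<sigma> * x)"
  have s: "s > 0" using t \<sigma> x by (simp add: s_def)
  have rv: "Z i \<in> borel_measurable M" if "i \<in> I" for i
    using indep that by (auto simp: indep_vars_def)
  have "prob {\<omega> \<in> space M. (\<Sum>i\<in>I. w i * Z i \<omega>) < - (\<sigma> * x * t)}
      \<le> prob {\<omega> \<in> space M. (\<Sum>i\<in>I. w i * Z i \<omega>) \<le> - (\<sigma> * x * t)}"
    using rv by (intro finite_measure_mono) auto
  also have "\<dots> \<le> exp (s * (- (\<sigma> * x * t)) + (\<Sum>i\<in>I. (s * w i)\<^sup>2 * \<sigma>\<^sup>2 / 2))"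
  proof (rule chernoff_lower_tail_sum[OF fin indep _ s])
    fix i assume "i \<in> I"
    show "(\<integral>\<^sup>+\<omega>. ennreal (exp (- s * (w i * Z i \<omega>))) \<partial>M) \<le> ennreal (exp ((s * w i)\<^sup>2 * \<sigma>\<^sup>2 / 2))"
      using normal_laplace_linear[OF \<sigma> Z[OF \<open>i \<in> I\<close>], of "- (s * w i)"] by (simp add: mult.assoc)
  qed simp
  also have "(\<Sum>i\<in>I. (s * w i)\<^sup>2 * \<sigma>\<^sup>2 / 2) = s\<^sup>2 * x\<^sup>2 * \<sigma>\<^sup>2 / 2"
    unfolding x by (simp add: power_mult_distrib sum_distrib_left sum_distrib_right sum_divide_distrib)
  also have "s * (- (\<sigma> * x * t)) + s\<^sup>2 * x\<^sup>2 * \<sigma>\<^sup>2 / 2 = - t\<^sup>2 / 2"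
    using \<sigma> x(1) by (simp add: s_def power_divide power_mult_distrib power2_eq_square)
  finally show ?thesis by (simp add: x_def)
qed

text \<open>The lower tail of a chi-squared variable with \<open>n = card I\<close> degrees of freedom. With \<open>l = s * \<sigma>\<^sup>2\<close> the exponent is at
  most \<open>2 * n * l\<^sup>2 - 2 * e * l\<close>, by \<open>ln (1 + 2 * l) \<ge> 2 * l - 4 * l\<^sup>2\<close>, and \<open>l = e / (2 * n)\<close> minimises it. The
  bound on \<open>e\<close> says \<open>2 * l \<le> 1\<close>, the range in which the logarithm is estimated.\<close>

lemma normal_square_sum_lower_tail:
  fixes Z :: "'i \<Rightarrow> 'a \<Rightarrow> real"
  assumes fin: "finite I" and indep: "indep_vars (\<lambda>_. borel) Z I" and \<sigma>: "\<sigma> > 0"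
    and Z: "\<And>i. i \<in> I \<Longrightarrow> distributed M lborel (Z i) (normal_density 0 \<sigma>)"
    and e: "0 < e" "e \<le> real (card I)"
  shows "prob {\<omega> \<in> space M. (\<Sum>i\<in>I. (Z i \<omega>)\<^sup>2) \<le> \<sigma>\<^sup>2 * (real (card I) - 2 * e)}
    \<le> exp (- (e\<^sup>2 / (2 * real (card I))))"
proof -
  define n where "n = real (card I)"
  define l where "l = e / (2 * n)"
  have l: "0 < l" "2 * l \<le> 1" using e by (auto simp: l_def n_def field_simps)
  define s where "s = l / \<sigma>\<^sup>2"
  have s: "s > 0" "s * \<sigma>\<^sup>2 = l" using l \<sigma> by (auto simp: s_def)
  have "prob {\<omega> \<in> space M. (\<Sum>i\<in>I. (Z i \<omega>)\<^sup>2) \<le> \<sigma>\<^sup>2 * (n - 2 * e)}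
    \<le> exp (s * (\<sigma>\<^sup>2 * (n - 2 * e)) + (\<Sum>i\<in>I. - (l - 2 * l\<^sup>2)))"
  proof (rule chernoff_lower_tail_sum[OF fin indep _ s(1)])
    fix i assume i: "i \<in> I"
    have "2 * l - (2 * l)\<^sup>2 \<le> ln (1 + 2 * l)"
      using l by (intro ln_one_plus_pos_lower_bound) auto
    then have "exp (2 * (l - 2 * l\<^sup>2)) \<le> 1 + 2 * l"
      using l by (subst ln_ge_iff[symmetric]) (auto simp: power2_eq_square algebra_simps)
    moreover have "exp (2 * (l - 2 * l\<^sup>2)) = (exp (l - 2 * l\<^sup>2))\<^sup>2" by (rule exp_double)
    ultimately have "exp (l - 2 * l\<^sup>2) \<le> sqrt (1 + 2 * l)" by (intro real_le_rsqrt) simp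
    then have "1 / sqrt (1 + 2 * l) \<le> 1 / exp (l - 2 * l\<^sup>2)"
      using l by (intro divide_left_mono) auto
    also have "\<dots> = exp (- (l - 2 * l\<^sup>2))" by (simp only: exp_minus inverse_eq_divide)
    finally have "1 / sqrt (1 + 2 * s * \<sigma>\<^sup>2) \<le> exp (- (l - 2 * l\<^sup>2))"
      by (simp only: mult.assoc s(2))
    then show "(\<integral>\<^sup>+\<omega>. ennreal (exp (- s * (Z i \<omega>)\<^sup>2)) \<partial>M) \<le> ennreal (exp (- (l - 2 * l\<^sup>2)))"
      unfolding normal_laplace_square[OF \<sigma> Z[OF i] less_imp_le[OF s(1)]] by (rule ennreal_leI)
  qed simp
  also have "s * (\<sigma>\<^sup>2 * (n - 2 * e)) + (\<Sum>i\<in>I. - (l - 2 * l\<^sup>2)) = - (e\<^sup>2 / (2 * n))"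
  proof -
    have "s * (\<sigma>\<^sup>2 * (n - 2 * e)) = l * (n - 2 * e)" using s(2) by (simp only: mult.assoc[symmetric])
    then have "s * (\<sigma>\<^sup>2 * (n - 2 * e)) + (\<Sum>i\<in>I. - (l - 2 * l\<^sup>2)) = 2 * n * l\<^sup>2 - 2 * e * l"
      by (simp add: n_def algebra_simps)
    also have "\<dots> = - (e\<^sup>2 / (2 * n))"
      using e by (simp add: l_def n_def field_simps power2_eq_square)
    finally show ?thesis .
  qed
  finally show ?thesis by (simp add: n_def)
qed

end

text \<open>Here \<open>x\<close> is the norm of the signal, \<open>W\<close> its inner product with the noise and \<open>Q\<close> the squared norm of the noise.
  With \<open>K = \<bar>S - m * s\<^sup>2\<bar>\<close>, completing the square gives \<open>(x - sqrt 2 * s * u)\<^sup>2 < K + 4 * s\<^sup>2 * u\<^sup>2\<close>, and the root of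
  the right-hand side is at most \<open>sqrt K + 2 * s * u\<close>.\<close>

lemma norm_bound_from_noise:
  fixes x S W Q s m u :: real
  assumes S: "S = x\<^sup>2 + 2 * W + Q" and W: "W \<ge> - (s * x * (sqrt 2 * u))"
    and Q: "Q > s\<^sup>2 * (m - 2 * u\<^sup>2)" and x: "x \<ge> 0" and s: "s > 0" and u: "u > 0"
  shows "x\<^sup>2 < (sqrt \<bar>S - m * s\<^sup>2\<bar> + (2 + sqrt 2) * s * u)\<^sup>2"
proof -
  define K where "K = \<bar>S - m * s\<^sup>2\<bar>"
  have "x\<^sup>2 < K + 2 * (sqrt 2 * s * u) * x + 2 * (s * u)\<^sup>2"
    using S W Q by (simp add: K_def algebra_simps power_mult_distrib)
  then have "(x - sqrt 2 * s * u)\<^sup>2 < K + (2 * (s * u))\<^sup>2"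
    by (simp add: power2_diff power_mult_distrib algebra_simps)
  also have "\<dots> \<le> (sqrt K + 2 * (s * u))\<^sup>2"
    using s u by (simp add: power2_sum K_def)
  finally have "\<bar>x - sqrt 2 * s * u\<bar> < \<bar>sqrt K + 2 * (s * u)\<bar>"
    by (metis abs_le_square_iff not_le)
  moreover have "sqrt K + 2 * (s * u) \<ge> 0" using s u by (simp add: K_def)
  ultimately have "x < sqrt K + (2 + sqrt 2) * s * u" by (simp add: algebra_simps)
  then show ?thesis unfolding K_def[symmetric] using x by (intro power_strict_mono) auto
qed

text \<open>With \<open>u = m powr ((1 + \<delta>) / 4)\<close>, the linear tail is used at \<open>t = sqrt 2 * u\<close>, where its exponent is \<open>- u\<^sup>2\<close>, and the
  quadratic tail, with \<open>2 * m\<close> degrees of freedom, at \<open>e = u\<^sup>2\<close>, where it is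
  \<open>- u ^ 4 / (4 * m) = - (m powr \<delta>) / 4\<close>.\<close>

lemma (in prob_space) noise_norm_bound:
  fixes N :: nat and \<sigma> \<delta> :: real and v :: "int \<Rightarrow> complex" and X :: "int \<Rightarrow> nat \<Rightarrow> 'a \<Rightarrow> real"
  defines "m \<equiv> 2 * real N + 1"
  assumes \<sigma>: "\<sigma> > 0" and \<delta>: "0 < \<delta>" "\<delta> < 1"
    and indep: "indep_vars (\<lambda>_. borel) (\<lambda>(k, j). X k j) ({- int N..int N} \<times> {1, 2})"
    and X: "\<And>k j. k \<in> {- int N..int N} \<Longrightarrow> j \<in> {1, 2} \<Longrightarrow>
           distributed M lborel (X k j) (normal_density 0 \<sigma>)"
  shows "prob {\<omega> \<in> space M. \<not> (\<Sum>k\<in>{- int N..int N}. (cmod (v k))\<^sup>2)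
      < (sqrt \<bar>(\<Sum>k\<in>{- int N..int N}. (cmod (v k + Complex (X k 1 \<omega>) (X k 2 \<omega>)))\<^sup>2) - 2 * m * \<sigma>\<^sup>2\<bar>
          + (2 + sqrt 2) * \<sigma> * m powr ((1 + \<delta>) / 4))\<^sup>2}
    \<le> exp (- (m powr ((1 + \<delta>) / 2))) + exp (- (m powr \<delta>) / 4)"
    (is "prob ?bad \<le> _")
proof -
  define J :: "(int \<times> nat) set" where "J = {- int N..int N} \<times> {1, 2}"
  define Z where "Z = (\<lambda>(k, j). X k j)"
  define w where "w = (\<lambda>(k, j::nat). if j = 1 then Re (v k) else Im (v k))"
  define x where "x = sqrt (\<Sum>k\<in>{- int N..int N}. (cmod (v k))\<^sup>2)"
  define u where "u = m powr ((1 + \<delta>) / 4)"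
  have m: "m \<ge> 1" by (simp add: m_def)
  have u: "u > 0" using m by (simp add: u_def)
  have u2: "u\<^sup>2 = m powr ((1 + \<delta>) / 2)"
    using m by (simp add: u_def power2_eq_square powr_add[symmetric])
  have u4: "(u\<^sup>2)\<^sup>2 = m * m powr \<delta>"
    using m unfolding u2 by (simp add: power2_eq_square powr_add[symmetric]) (simp add: powr_add)
  have u2_le: "u\<^sup>2 \<le> m"
    unfolding u2 using powr_mono[of "(1 + \<delta>) / 2" 1 m] m \<delta> by simp
  have finJ: "finite J" by (simp add: J_def)
  have cardJ: "real (card J) = 2 * m" by (simp add: J_def m_def card_cartesian_product)
  have sumJ: "(\<Sum>i\<in>J. G i) = (\<Sum>k\<in>{- int N..int N}. G (k, 1) + G (k, 2))" for G :: "int \<times> nat \<Rightarrow> real"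
    unfolding J_def 
    using sum.cartesian_product[of "\<lambda>k j. G (k, j)" "{1, 2}" "{- int N..int N}"] by simp
  have indepJ: "indep_vars (\<lambda>_. borel) Z J" using indep by (simp add: J_def Z_def)
  have distJ: "distributed M lborel (Z i) (normal_density 0 \<sigma>)" if "i \<in> J" for i
    using that X by (auto simp: J_def Z_def)
  have rv: "Z i \<in> borel_measurable M" if "i \<in> J" for i
    using indepJ that by (auto simp: indep_vars_def)
  have x: "x \<ge> 0" "x\<^sup>2 = (\<Sum>k\<in>{- int N..int N}. (cmod (v k))\<^sup>2)"
    by (simp_all add: x_def sum_nonneg)
  have w2: "(\<Sum>i\<in>J. (w i)\<^sup>2) = (\<Sum>k\<in>{- int N..int N}. (cmod (v k))\<^sup>2)"
    unfolding sumJ by (simp add: w_def cmod_power2)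
  define bad1 where "bad1 = {\<omega> \<in> space M. (\<Sum>i\<in>J. w i * Z i \<omega>) < - (\<sigma> * x * (sqrt 2 * u))}"
  define bad2 where "bad2 = {\<omega> \<in> space M. (\<Sum>i\<in>J. (Z i \<omega>)\<^sup>2) \<le> \<sigma>\<^sup>2 * (2 * m - 2 * u\<^sup>2)}"
  have sets: "bad1 \<in> events" "bad2 \<in> events"
    unfolding bad1_def bad2_def using rv by measurable
  have p1: "prob bad1 \<le> exp (- (m powr ((1 + \<delta>) / 2)))"
    using normal_linear_lower_tail[OF finJ indepJ \<sigma> distJ, of "sqrt 2 * u" w] u
    by (simp add: bad1_def w2 x_def power_mult_distrib u2)
  have p2: "prob bad2 \<le> exp (- (m powr \<delta>) / 4)"
  proof -
    have "prob bad2 \<le> exp (- ((u\<^sup>2)\<^sup>2 / (2 * real (card J))))"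
      unfolding bad2_def cardJ[symmetric]
      by (rule normal_square_sum_lower_tail[OF finJ indepJ \<sigma> distJ]) (use u u2_le m cardJ in auto)
    also have "(u\<^sup>2)\<^sup>2 / (2 * real (card J)) = m powr \<delta> / 4"
      unfolding u4 cardJ using m by simp
    finally show ?thesis by simp
  qed
  have "?bad \<subseteq> bad1 \<union> bad2"
  proof (rule subsetI, rule ccontr)
    fix \<omega> assume b: "\<omega> \<in> ?bad" and nb: "\<omega> \<notin> bad1 \<union> bad2"
    have "(\<Sum>k\<in>{- int N..int N}. (cmod (v k + Complex (X k 1 \<omega>) (X k 2 \<omega>)))\<^sup>2)
        = x\<^sup>2 + 2 * (\<Sum>i\<in>J. w i * Z i \<omega>) + (\<Sum>i\<in>J. (Z i \<omega>)\<^sup>2)"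
      unfolding sumJ x sum_distrib_left sum.distrib[symmetric]
      by (intro sum.cong refl) (simp add: w_def Z_def cmod_power2 power2_sum algebra_simps)
    moreover have "(\<Sum>i\<in>J. w i * Z i \<omega>) \<ge> - (\<sigma> * x * (sqrt 2 * u))"
      "(\<Sum>i\<in>J. (Z i \<omega>)\<^sup>2) > \<sigma>\<^sup>2 * (2 * m - 2 * u\<^sup>2)"
      using b nb by (auto simp: bad1_def bad2_def)
    ultimately have "x\<^sup>2 < (sqrt \<bar>(\<Sum>k\<in>{- int N..int N}. (cmod (v k + Complex (X k 1 \<omega>) (X k 2 \<omega>)))\<^sup>2)
        - 2 * m * \<sigma>\<^sup>2\<bar> + (2 + sqrt 2) * \<sigma> * u)\<^sup>2"
      using x(1) \<sigma> u by (rule norm_bound_from_noise)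
    then show False using b unfolding x(2) u_def by simp
  qed
  then have "prob ?bad \<le> prob (bad1 \<union> bad2)" using sets by (intro finite_measure_mono) auto
  also have "\<dots> \<le> prob bad1 + prob bad2" using sets by (intro measure_Un_le)
  finally show ?thesis using p1 p2 by simp
qed

section \<open>Stability of the frequencies under noise\<close>

theorem corollary5p3:
  fixes N :: nat and q c_min \<sigma> \<delta> :: real
    and f g :: "real \<Rightarrow> complex"
    and M :: "'a measure" and X :: "int \<Rightarrow> nat \<Rightarrow> 'a \<Rightarrow> real"
    and \<eta> :: "int \<Rightarrow> 'a \<Rightarrow> complex" and R :: "'a \<Rightarrow> real"
    and n :: "real \<Rightarrow> real"
  assumes "N \<ge> 1"
    and "q \<ge> 3 / (2 * real N + 2)"
    and "f \<in> separated_exp_sums (2 * q)" and "g \<in> separated_exp_sums (2 * q)"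
    and "c_min > 0"
    and "\<And>y. y \<in> exp_freqs f \<Longrightarrow> cmod (exp_coeff f y) \<ge> c_min"
    and "\<And>y. y \<in> exp_freqs g \<Longrightarrow> cmod (exp_coeff g y) \<ge> c_min"
    and "\<sigma> > 0" and "0 < \<delta>" and "\<delta> < 1"
    and "prob_space M"
    and "prob_space.indep_vars M (\<lambda>_. borel) (\<lambda>(k, j). X k j) ({- int N..int N} \<times> {1, 2})"
    and "\<And>k j. k \<in> {- int N..int N} \<Longrightarrow> j \<in> {1, 2} \<Longrightarrow>
           distributed M lborel (X k j) (normal_density 0 \<sigma>)"
  defines "\<eta> \<equiv> \<lambda>k \<omega>. Complex (X k 1 \<omega>) (X k 2 \<omega>)"
    and "R \<equiv> \<lambda>\<omega>.
      (sqrt \<bar>(L2_set (\<lambda>k. cmod (f (of_int k) + \<eta> k \<omega> - g (of_int k))) {- int N..int N})\<^sup>2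
             - 2 * (2 * real N + 1) * \<sigma>\<^sup>2\<bar>
       + (2 + sqrt 2) * \<sigma> * (2 * real N + 1) powr ((1 + \<delta>) / 4))\<^sup>2"
    and "n \<equiv> \<lambda>y. THE z. z \<in> exp_freqs g \<and> wrap_dist y z < 3 / (2 * real N + 2)"
  shows "measure M {\<omega> \<in> space M.
      R \<omega> \<le> (4 * real N + 4) / 3 * c_min\<^sup>2 \<longrightarrow>
        (\<forall>y\<in>exp_freqs f. \<exists>!z. z \<in> exp_freqs g \<and> wrap_dist y z < 3 / (2 * real N + 2)) \<and>
        (\<Sum>y\<in>exp_freqs f.
            (real N + 1) / 3 * (cmod (exp_coeff f y - exp_coeff g (n y)))\<^sup>2
          + 2 * pi\<^sup>2 * (real N + 1) ^ 3 / 3 ^ 5 * (wrap_dist y (n y))\<^sup>2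
              * (cmod (exp_coeff f y + exp_coeff g (n y)))\<^sup>2) \<le> R \<omega>}
    \<ge> 1 - exp (- ((2 * real N + 1) powr ((1 + \<delta>) / 2))) - 2 * exp (- ((2 * real N + 1) powr \<delta>) / 8)"
proof -
  interpret prob_space M by (rule assms)
  define m where "m = 2 * real N + 1"
  define v where "v = (\<lambda>k::int. f (of_int k) - g (of_int k))"
  define D where "D = (\<Sum>k\<in>{- int N..int N}. (cmod (v k))\<^sup>2)"
  define P where "P \<longleftrightarrow> (\<forall>y\<in>exp_freqs f. \<exists>!z. z \<in> exp_freqs g \<and> wrap_dist y z < 3 / (2 * real N + 2))"
  define E where "E = (\<Sum>y\<in>exp_freqs f.
            (real N + 1) / 3 * (cmod (exp_coeff f y - exp_coeff g (n y)))\<^sup>2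
          + 2 * pi\<^sup>2 * (real N + 1) ^ 3 / 3 ^ 5 * (wrap_dist y (n y))\<^sup>2
              * (cmod (exp_coeff f y + exp_coeff g (n y)))\<^sup>2)"
  have L2: "(L2_set (\<lambda>k. cmod (f (of_int k) + \<eta> k \<omega> - g (of_int k))) {- int N..int N})\<^sup>2
      = (\<Sum>k\<in>{- int N..int N}. (cmod (v k + Complex (X k 1 \<omega>) (X k 2 \<omega>)))\<^sup>2)" for \<omega>
    by (simp add: L2_set_def sum_nonneg v_def \<eta>_def algebra_simps)
  have R_eq: "R \<omega> = (sqrt \<bar>(\<Sum>k\<in>{- int N..int N}. (cmod (v k + Complex (X k 1 \<omega>) (X k 2 \<omega>)))\<^sup>2) - 2 * m * \<sigma>\<^sup>2\<bar>
          + (2 + sqrt 2) * \<sigma> * m powr ((1 + \<delta>) / 4))\<^sup>2" for \<omega>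
    unfolding R_def L2 m_def ..
  have X_rv: "X k j \<in> borel_measurable M" if "k \<in> {- int N..int N}" "j \<in> {1, 2}" for k j
    using distributed_measurable[OF assms(13)[OF that]] by simp
  have R_rv: "R \<in> borel_measurable M"
  proof -
    have "(\<lambda>\<omega>. (cmod (v k + Complex (X k 1 \<omega>) (X k 2 \<omega>)))\<^sup>2) \<in> borel_measurable M"
      if "k \<in> {- int N..int N}" for k
      unfolding cmod_power2 using X_rv[OF that, of 1] X_rv[OF that, of 2] by simp
    then show ?thesis unfolding R_eq[abs_def] by measurable
  qed
  have good: "P \<and> E \<le> R \<omega>" if "D < R \<omega>" "R \<omega> \<le> (4 * real N + 4) / 3 * c_min\<^sup>2" for \<omega>
  proof -
    have less: "(\<Sum>k\<in>{- int N..int N}. (cmod (f (of_int k) - g (of_int k)))\<^sup>2) < (4 * real N + 4) / 3 * c_min\<^sup>2"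
      using that by (simp add: D_def v_def)
    have P unfolding P_def by (rule frequency_stability(1)[OF assms(1-6) less])
    moreover have "E \<le> D"
      unfolding E_def D_def v_def n_def by (rule frequency_stability(2)[OF assms(1-6) less])
    ultimately show ?thesis using that by simp
  qed
  have "1 - prob {\<omega> \<in> space M. \<not> D < R \<omega>} = prob {\<omega> \<in> space M. D < R \<omega>}"
    using R_rv by (subst prob_neg) auto
  also have "\<dots> \<le> prob {\<omega> \<in> space M. R \<omega> \<le> (4 * real N + 4) / 3 * c_min\<^sup>2 \<longrightarrow> P \<and> E \<le> R \<omega>}"
    using R_rv good by (intro finite_measure_mono) auto
  finally have "1 - prob {\<omega> \<in> space M. \<not> D < R \<omega>}
      \<le> prob {\<omega> \<in> space M. R \<omega> \<le> (4 * real N + 4) / 3 * c_min\<^sup>2 \<longrightarrow> P \<and> E \<le> R \<omega>}" .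
  moreover have "prob {\<omega> \<in> space M. \<not> D < R \<omega>} \<le> exp (- (m powr ((1 + \<delta>) / 2))) + exp (- (m powr \<delta>) / 4)"
    unfolding R_eq D_def m_def
    by (rule noise_norm_bound) (use assms(8-10,12,13) in auto)
  moreover have "exp (- (m powr \<delta>) / 4) \<le> 2 * exp (- (m powr \<delta>) / 8)"
  proof -
    have "exp (- (m powr \<delta>) / 4) \<le> exp (- (m powr \<delta>) / 8)" by simp
    also have "\<dots> \<le> 2 * exp (- (m powr \<delta>) / 8)" by simp
    finally show ?thesis .
  qed
  ultimately show ?thesis unfolding P_def E_def m_def by linarith
qed

end
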